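(* Let $X,Y,Z,f,g,h_1,\dots,h_s,l$ be the data of the constrained variational problem described in the context, let $\mathbb{P}$ be the optimal value of the convex program over measures $$\mathbb{P} := \inf_{(\mu,\nu_1,\ldots,\nu_s)\in\mathcal{M}} \langle l,\mu\rangle ,$$ and let $\mathbb{D}$ be the optimal value of the convex program over Lagrange multipliers $$\mathbb{D} := \sup_{(a,\phi,\psi_1,\ldots,\psi_s,\theta)\in M}\left\{ |X| \inf_{(x,y,z)\in\Omega} F(x,y,z) + \sum_{i=1}^s |\partial X_i| \inf_{(x,y)\in\Gamma_i} G_i(x,y)\right\},$$ where $\mathcal{M}$, $M$, $\Omega$, $\Gamma_i$, $F$ and $G_i$ are defined in the context ($F$ and $G_i$ depend on $(a,\phi,\psi_1,\ldots,\psi_s,\theta)$). 1. The two programs are weakly dual, that is, the program defining $\mathbb{D}$ is the Lagrangian dual of the program defining $\mathbb{P}$: $$\mathbb{P}=\inf_{(\mu,\nu_1,\ldots,\nu_s)\in N}\ \sup_{(a,\phi,\psi_1,\ldots,\psi_s,\theta)\in M}\Big\{\langle F,\mu\rangle+\sum_{i=1}^s\langle G_i,\nu_i\rangle\Big\},\qquad \mathbb{D}=\sup_{(a,\phi,\psi_1,\ldots,\psi_s,\theta)\in M}\ \inf_{(\mu,\nu_1,\ldots,\nu_s)\in N}\Big\{\langle F,\mu\rangle+\sum_{i=1}^s\langle G_i,\nu_i\rangle\Big\},$$ with $N$ as in the context, and $$\mathbb{D}\le\mathbb{P}.$$ 2. If the sets $Y$ and $Z$ are bounded, then the duality is strong,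 meaning that $\mathbb{P}=\mathbb{D}$.
   Context: **Setting.** $X\subset\mathbb{R}^n$ is an open bounded domain with Lipschitz boundary $\partial X=\overline{X}\setminus X$ consisting of $s$ smooth surfaces $\partial X_1,\ldots,\partial X_s$, which are closed sets and are disjoint up to a set of zero surface measure. On each $\partial X_i$, $\hat n(x)$ denotes the outward unit normal vector to $\partial X_i$, which is continuous on $\partial X_i$. $\mathrm{d}\sigma$ is the surface measure; $|X|=\int_X\mathrm{d}x$ and $|\partial X_i|=\int_{\partial X_i}\mathrm{d}\sigma$. $Y\subseteq\mathbb{R}^m$ and $Z\subseteq\mathbb{R}^{m\times n}$ are sets, bounded or unbounded, possibly the full spaces. The real-valued functions $l,f,g\in C(\overline{X}\times\mathbb{R}^m\times\mathbb{R}^{m\times n})$ and $h_i\in C(\partial X_i\times\mathbb{R}^m)$, $i=1,\ldots,s$, are given. Let $\mathcal{U}$ be the set of all $u\in W^{1,\infty}(X;\mathbb{R}^m)$ such that $\int_X f(x,u,Du)\,\mathrm{d}x=0$; $g(x,u,Du)=0$ a.e. on $X$; $h_i(x,u)=0$ a.e. on $\partial X_i$ for $i=1,\ldots,s$; $u\in Y$ a.e. on $X$; and $Du\in Z$ a.e. on $X$. Here $Du=(\partial_{x_j}u_i)$ is the $m\times n$ Jacobian matrix. It is assumed that $\mathcal{U}$ is nonempty and that $u\mapsto\int_X l(x,u,Du)\,\mathrm{d}x$ is bounded below on $\mathcal{U}$. **Notation.** $\Omega:=\overline{X}\times\overline{Y}\times\overline{Z}$ and $\Gamma_i:=\partial X_i\times\overline{Y}$,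 with points $(x,y,z)\in\Omega$ and $(x,y)\in\Gamma_i$. Functions in $C^1(\overline{X}\times\overline{Y};\mathbb{R}^n)$ are understood as $C^1$ functions on $\mathbb{R}^n\times\mathbb{R}^m$ considered on $\overline{X}\times\overline{Y}$ together with their first derivatives. For such $\theta$, $\nabla_x\cdot\theta$ is the divergence with respect to $x$, and $D_y\theta=(\partial_{y_j}\theta_i)_{i=1,\ldots,n}^{j=1,\ldots,m}$ is the $n\times m$ Jacobian with respect to $y$; $\operatorname{tr}$ is the trace. **Multipliers.** $M:=\mathbb{R}\times C(\Omega)\times C(\Gamma_1)\times\cdots\times C(\Gamma_s)\times C^1(\overline{X}\times\overline{Y};\mathbb{R}^n)$. For $(a,\phi,\psi_1,\ldots,\psi_s,\theta)\in M$ set $$F(x,y,z):=l(x,y,z)+a f(x,y,z)+\phi(x,y,z)g(x,y,z)+\nabla_x\cdot\theta(x,y)+\operatorname{tr}[z\,D_y\theta(x,y)],$$ $$G_i(x,y):=\psi_i(x,y)h_i(x,y)-\theta(x,y)\cdot\hat n(x),\quad i=1,\ldots,s.$$ **Measures.** For a measure $\mu$ on $\Omega$ and a measure $\nu_i$ on $\Gamma_i$, $\langle\eta,\mu\rangle:=\int_\Omega\eta\,\mathrm{d}\mu$ and $\langle\xi,\nu_i\rangle:=\int_{\Gamma_i}\xi\,\mathrm{d}\nu_i$. $N$ is the set of tuples $(\mu,\nu_1,\ldots,\nu_s)$ of non-negative Borel measures, $\mu$ on $\Omega$ and $\nu_i$ on $\Gamma_i$, with masses $\langle 1,\mu\rangle=|X|$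 and $\langle1,\nu_i\rangle=|\partial X_i|$ for each $i$, and for which all the pairings used here are well defined, i.e. $l$, $f$, $\phi g$, $\nabla_x\cdot\theta+\operatorname{tr}(z D_y\theta)$ are $\mu$-integrable and $\psi_i h_i$, $\theta\cdot\hat n$ are $\nu_i$-integrable for all $(a,\phi,\psi_1,\ldots,\psi_s,\theta)\in M$ (automatic if $Y$ and $Z$ are bounded). $\mathcal{M}$ is the set of $(\mu,\nu_1,\ldots,\nu_s)\in N$ such that - $\langle f,\mu\rangle=0$; - $\langle\phi g,\mu\rangle=0$ for all $\phi\in C(\Omega)$; - $\langle\psi_i h_i,\nu_i\rangle=0$ for all $\psi_i\in C(\Gamma_i)$ and all $i=1,\ldots,s$; - $\langle\nabla_x\cdot\theta+\operatorname{tr}(z\,D_y\theta),\mu\rangle-\sum_{i=1}^s\langle\theta\cdot\hat n,\nu_i\rangle=0$ for all $\theta\in C^1(\overline{X}\times\overline{Y};\mathbb{R}^n)$. Infima and suprema take values in $[-\infty,+\infty]$. *)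

theory Defs
  imports "HOL-Analysis.Analysis"
begin

section \<open>Smooth functions and surface measure\<close>

primrec Ck_on :: "nat \<Rightarrow> 'a::euclidean_space set \<Rightarrow> ('a \<Rightarrow> real) \<Rightarrow> bool" where
  "Ck_on 0 U f \<longleftrightarrow> continuous_on U f"
| "Ck_on (Suc k) U f \<longleftrightarrow>
     (\<forall>x\<in>U. f differentiable (at x)) \<and> (\<forall>v. Ck_on k U (\<lambda>x. frechet_derivative f (at x) v))"

definition smooth_on :: "'a::euclidean_space set \<Rightarrow> ('a \<Rightarrow> real) \<Rightarrow> bool" where
  "smooth_on U f \<longleftrightarrow> open U \<and> (\<forall>k. Ck_on k U f)"

text \<open>The \<open>d\<close>-dimensional Hausdorff outer measure, normalised so as to agree with the
  \<open>d\<close>-dimensional area on \<open>d\<close>-dimensional smooth surfaces. The empty set gets weight 0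
  separately, because \<open>0 ^ 0 = 1\<close>.\<close>

definition hausdorff_pre :: "nat \<Rightarrow> real \<Rightarrow> 'a::metric_space set \<Rightarrow> ennreal" where
  "hausdorff_pre d \<delta> A =
     (INF C \<in> {C :: nat \<Rightarrow> 'a set. A \<subseteq> (\<Union>k. C k) \<and> (\<forall>k. bounded (C k) \<and> diameter (C k) \<le> \<delta>)}.
        \<Sum>k. if C k = {} then 0 else ennreal (unit_ball_vol (real d) * (diameter (C k) / 2) ^ d))"

definition hausdorff :: "nat \<Rightarrow> 'a::metric_space set \<Rightarrow> ennreal" where
  "hausdorff d A = (SUP \<delta>\<in>{0<..}. hausdorff_pre d \<delta> A)"

definition surface_measure :: "(real ^ 'n) set \<Rightarrow> ennreal" where
  "surface_measure A = hausdorff (CARD('n) - 1) A"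

text \<open>\<open>enn2real\<close> loses nothing here: pieces of the boundary of a bounded Lipschitz domain
  have finite surface measure.\<close>

definition area :: "(real ^ 'n) set \<Rightarrow> real" where
  "area A = enn2real (surface_measure A)"

definition volume :: "(real ^ 'n) set \<Rightarrow> real" where
  "volume A = measure lebesgue A"


section \<open>Lipschitz domains with piecewise smooth boundary\<close>

text \<open>Near each boundary point, \<open>X\<close> is the part below the graph, in some direction \<open>e\<close>, of a
  Lipschitz function \<open>\<gamma>\<close> of the component orthogonal to \<open>e\<close>.\<close>

definition lipschitz_boundary :: "(real ^ 'n) set \<Rightarrow> bool" where
  "lipschitz_boundary X \<longleftrightarrow>
     (\<forall>p\<in>frontier X. \<exists>U e (\<gamma> :: real ^ 'n \<Rightarrow> real) L.
        open U \<and> p \<in> U \<and> norm e = 1 \<and> L-lipschitz_on UNIV \<gamma> \<and>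
        X \<inter> U = {x\<in>U. x \<bullet> e < \<gamma> (x - (x \<bullet> e) *\<^sub>R e)})"

definition defining_function :: "(real ^ 'n) set \<Rightarrow> (real ^ 'n \<Rightarrow> real) \<Rightarrow> bool" where
  "defining_function U \<rho> \<longleftrightarrow> smooth_on U \<rho> \<and> (\<forall>x\<in>U. \<not> (GDERIV \<rho> x :> 0))"

text \<open>\<open>p\<close> is a point in the relative interior of the piece \<open>S\<close> of \<open>frontier X\<close>, and \<open>\<nu>\<close> is the
  outward unit normal there: locally \<open>X = {\<rho> < 0}\<close> and \<open>S = {\<rho> = 0}\<close>, and \<open>\<nu>\<close> is the
  normalised gradient of \<open>\<rho>\<close>.\<close>

definition normal_at :: "(real ^ 'n) set \<Rightarrow> (real ^ 'n) set \<Rightarrow> real ^ 'n \<Rightarrow> real ^ 'n \<Rightarrow> bool" where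
  "normal_at X S p \<nu> \<longleftrightarrow>
     (\<exists>U \<rho> D. p \<in> U \<and> defining_function U \<rho> \<and>
        X \<inter> U = {x\<in>U. \<rho> x < 0} \<and> S \<inter> U = {x\<in>U. \<rho> x = 0} \<and>
        (GDERIV \<rho> p :> D) \<and> \<nu> = sgn D)"

text \<open>A closed smooth surface, possibly with relative boundary (such as a face of a cube): it is
  the closure of its relative interior, and at all its points, edges included, it is locally
  contained in a smooth hypersurface.\<close>

definition smooth_piece :: "(real ^ 'n) set \<Rightarrow> (real ^ 'n) set \<Rightarrow> bool" where
  "smooth_piece X S \<longleftrightarrow>
     closed S \<and>
     (\<forall>p\<in>S. \<exists>U \<rho>. p \<in> U \<and> defining_function U \<rho> \<and> S \<inter> U \<subseteq> {x. \<rho> x = 0}) \<and>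
     S \<subseteq> closure {p\<in>S. \<exists>\<nu>. normal_at X S p \<nu>}"

text \<open>At edge points of a smooth piece the normal is determined by continuity, since the relative
  interior is dense.\<close>

definition outward_unit_normal ::
    "(real ^ 'n) set \<Rightarrow> (real ^ 'n) set \<Rightarrow> (real ^ 'n \<Rightarrow> real ^ 'n) \<Rightarrow> bool" where
  "outward_unit_normal X S n \<longleftrightarrow>
     continuous_on S n \<and> (\<forall>p\<in>S. norm (n p) = 1) \<and>
     (\<forall>p\<in>S. \<forall>\<nu>. normal_at X S p \<nu> \<longrightarrow> n p = \<nu>)"

definition variational_domain ::
    "(real ^ 'n) set \<Rightarrow> ('s::finite \<Rightarrow> (real ^ 'n) set) \<Rightarrow> ('s \<Rightarrow> real ^ 'n \<Rightarrow> real ^ 'n) \<Rightarrow> bool" where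
  "variational_domain X S n \<longleftrightarrow>
     X \<noteq> {} \<and> open X \<and> connected X \<and> bounded X \<and> lipschitz_boundary X \<and>
     frontier X = (\<Union>i. S i) \<and>
     (\<forall>i. smooth_piece X (S i)) \<and>
     (\<forall>i j. i \<noteq> j \<longrightarrow> surface_measure (S i \<inter> S j) = 0) \<and>
     (\<forall>i. outward_unit_normal X (S i) (n i))"


section \<open>The variational problem\<close>

definition test_functions :: "(real ^ 'n) set \<Rightarrow> (real ^ 'n \<Rightarrow> real) set" where
  "test_functions X =
     {\<phi>. smooth_on UNIV \<phi> \<and> (\<exists>K. compact K \<and> K \<subseteq> X \<and> (\<forall>x. x \<notin> K \<longrightarrow> \<phi> x = 0))}"

definition weak_jacobian ::
    "(real ^ 'n) set \<Rightarrow> (real ^ 'n \<Rightarrow> real ^ 'm) \<Rightarrow> (real ^ 'n \<Rightarrow> real ^ 'n ^ 'm) \<Rightarrow> bool" where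
  "weak_jacobian X u V \<longleftrightarrow>
     V \<in> borel_measurable (lebesgue_on X) \<and>
     (\<forall>K. compact K \<and> K \<subseteq> X \<longrightarrow> integrable (lebesgue_on K) V) \<and>
     (\<forall>\<phi>\<in>test_functions X. \<forall>i j.
        (LINT x|lebesgue_on X. u x $ i * frechet_derivative \<phi> (at x) (axis j 1)) =
        - (LINT x|lebesgue_on X. V x $ i $ j * \<phi> x))"

text \<open>The weak Jacobian is unique up to null sets, so the choice is immaterial below.\<close>

definition Dw ::
    "(real ^ 'n) set \<Rightarrow> (real ^ 'n \<Rightarrow> real ^ 'm) \<Rightarrow> real ^ 'n \<Rightarrow> real ^ 'n ^ 'm" where
  "Dw X u = (SOME V. weak_jacobian X u V)"

definition W1inf :: "(real ^ 'n) set \<Rightarrow> (real ^ 'n \<Rightarrow> real ^ 'm) set" where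
  "W1inf X =
     {u. u \<in> borel_measurable (lebesgue_on X) \<and>
         (\<exists>C. AE x in lebesgue_on X. norm (u x) \<le> C) \<and>
         (\<exists>V. weak_jacobian X u V) \<and>
         (\<exists>C. AE x in lebesgue_on X. norm (Dw X u x) \<le> C)}"

text \<open>On a bounded Lipschitz domain a \<open>W1inf\<close> function has a unique representative that is
  continuous up to the boundary; its boundary values are the trace.\<close>

definition boundary_trace ::
    "(real ^ 'n) set \<Rightarrow> (real ^ 'n \<Rightarrow> real ^ 'm) \<Rightarrow> real ^ 'n \<Rightarrow> real ^ 'm" where
  "boundary_trace X u =
     (SOME w. continuous_on (closure X) w \<and> (AE x in lebesgue_on X. w x = u x))"

type_synonym ('n, 'm) jet = "(real ^ 'n) \<times> (real ^ 'm) \<times> (real ^ 'n ^ 'm)"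
type_synonym ('n, 'm) pt = "(real ^ 'n) \<times> (real ^ 'm)"

definition energy ::
    "(real ^ 'n) set \<Rightarrow> (('n, 'm) jet \<Rightarrow> real) \<Rightarrow> (real ^ 'n \<Rightarrow> real ^ 'm) \<Rightarrow> real" where
  "energy X l u = (LINT x|lebesgue_on X. l (x, u x, Dw X u x))"

definition admissible ::
    "(real ^ 'n) set \<Rightarrow> ('s \<Rightarrow> (real ^ 'n) set) \<Rightarrow> (real ^ 'm) set \<Rightarrow> (real ^ 'n ^ 'm) set \<Rightarrow>
     (('n, 'm) jet \<Rightarrow> real) \<Rightarrow> (('n, 'm) jet \<Rightarrow> real) \<Rightarrow> ('s \<Rightarrow> ('n, 'm) pt \<Rightarrow> real) \<Rightarrow>
     (real ^ 'n \<Rightarrow> real ^ 'm) set" where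
  "admissible X S Y Z f g h =
     {u \<in> W1inf X.
        energy X f u = 0 \<and>
        (AE x in lebesgue_on X. g (x, u x, Dw X u x) = 0) \<and>
        (\<forall>i. surface_measure {x \<in> S i. h i (x, boundary_trace X u x) \<noteq> 0} = 0) \<and>
        (AE x in lebesgue_on X. u x \<in> Y) \<and>
        (AE x in lebesgue_on X. Dw X u x \<in> Z)}"


section \<open>Multipliers\<close>

definition Omega ::
    "(real ^ 'n) set \<Rightarrow> (real ^ 'm) set \<Rightarrow> (real ^ 'n ^ 'm) set \<Rightarrow> ('n, 'm) jet set" where
  "Omega X Y Z = closure X \<times> closure Y \<times> closure Z"

definition Gam :: "('s \<Rightarrow> (real ^ 'n) set) \<Rightarrow> (real ^ 'm) set \<Rightarrow> 's \<Rightarrow> ('n, 'm) pt set" where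
  "Gam S Y i = S i \<times> closure Y"

definition C1_maps :: "(('n::finite, 'm::finite) pt \<Rightarrow> real ^ 'n) set" where
  "C1_maps =
     {\<theta>. (\<forall>p. \<theta> differentiable (at p)) \<and>
         (\<forall>v. continuous_on UNIV (\<lambda>p. frechet_derivative \<theta> (at p) v))}"

definition div_x :: "(('n::finite, 'm::finite) pt \<Rightarrow> real ^ 'n) \<Rightarrow> ('n, 'm) pt \<Rightarrow> real" where
  "div_x \<theta> p = (\<Sum>i\<in>UNIV. frechet_derivative \<theta> (at p) (axis i 1, 0) $ i)"

definition jac_y :: "(('n, 'm) pt \<Rightarrow> real ^ 'n) \<Rightarrow> ('n, 'm) pt \<Rightarrow> real ^ 'm ^ 'n" where
  "jac_y \<theta> p = (\<chi> i j. frechet_derivative \<theta> (at p) (0, axis j 1) $ i)"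

definition total_div :: "(('n::finite, 'm::finite) pt \<Rightarrow> real ^ 'n) \<Rightarrow> ('n, 'm) jet \<Rightarrow> real" where
  "total_div \<theta> = (\<lambda>(x, y, z). div_x \<theta> (x, y) + trace (z ** jac_y \<theta> (x, y)))"

definition flux ::
    "('s \<Rightarrow> real ^ 'n \<Rightarrow> real ^ 'n) \<Rightarrow> (('n::finite, 'm::finite) pt \<Rightarrow> real ^ 'n) \<Rightarrow> 's \<Rightarrow> ('n, 'm) pt \<Rightarrow> real" where
  "flux n \<theta> i = (\<lambda>(x, y). \<theta> (x, y) \<bullet> n i x)"

type_synonym ('n, 'm, 's) multiplier =
  "real \<times> (('n, 'm) jet \<Rightarrow> real) \<times> ('s \<Rightarrow> ('n, 'm) pt \<Rightarrow> real) \<times> (('n, 'm) pt \<Rightarrow> real ^ 'n)"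

definition multipliers ::
    "(real ^ 'n) set \<Rightarrow> ('s \<Rightarrow> (real ^ 'n) set) \<Rightarrow> (real ^ 'm) set \<Rightarrow> (real ^ 'n ^ 'm) set \<Rightarrow>
     ('n, 'm, 's) multiplier set" where
  "multipliers X S Y Z =
     {(a, \<phi>, \<psi>, \<theta>). continuous_on (Omega X Y Z) \<phi> \<and>
        (\<forall>i. continuous_on (Gam S Y i) (\<psi> i)) \<and> \<theta> \<in> C1_maps}"

definition F_fun ::
    "(('n::finite, 'm::finite) jet \<Rightarrow> real) \<Rightarrow> (('n, 'm) jet \<Rightarrow> real) \<Rightarrow> (('n, 'm) jet \<Rightarrow> real) \<Rightarrow>
     ('n, 'm, 's) multiplier \<Rightarrow> ('n, 'm) jet \<Rightarrow> real" where
  "F_fun l f g = (\<lambda>(a, \<phi>, \<psi>, \<theta>) q. l q + a * f q + \<phi> q * g q + total_div \<theta> q)"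

definition G_fun ::
    "('s \<Rightarrow> real ^ 'n \<Rightarrow> real ^ 'n) \<Rightarrow> ('s \<Rightarrow> ('n::finite, 'm::finite) pt \<Rightarrow> real) \<Rightarrow>
     ('n, 'm, 's) multiplier \<Rightarrow> 's \<Rightarrow> ('n, 'm) pt \<Rightarrow> real" where
  "G_fun n h = (\<lambda>(a, \<phi>, \<psi>, \<theta>) i p. \<psi> i p * h i p - flux n \<theta> i p)"


section \<open>Measures\<close>

type_synonym ('n, 'm, 's) measure_tuple = "('n, 'm) jet measure \<times> ('s \<Rightarrow> ('n, 'm) pt measure)"

definition measures_N ::
    "(real ^ 'n) set \<Rightarrow> ('s \<Rightarrow> (real ^ 'n) set) \<Rightarrow> ('s \<Rightarrow> real ^ 'n \<Rightarrow> real ^ 'n) \<Rightarrow>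
     (real ^ 'm) set \<Rightarrow> (real ^ 'n ^ 'm) set \<Rightarrow>
     (('n, 'm) jet \<Rightarrow> real) \<Rightarrow> (('n, 'm) jet \<Rightarrow> real) \<Rightarrow> (('n, 'm) jet \<Rightarrow> real) \<Rightarrow>
     ('s \<Rightarrow> ('n, 'm) pt \<Rightarrow> real) \<Rightarrow> ('n, 'm, 's) measure_tuple set" where
  "measures_N X S n Y Z l f g h =
     {(\<mu>, \<nu>).
        sets \<mu> = sets (restrict_space borel (Omega X Y Z)) \<and>
        emeasure \<mu> (Omega X Y Z) = ennreal (volume X) \<and>
        (\<forall>i. sets (\<nu> i) = sets (restrict_space borel (Gam S Y i)) \<and>
             emeasure (\<nu> i) (Gam S Y i) = ennreal (area (S i))) \<and>
        integrable \<mu> l \<and> integrable \<mu> f \<and>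
        (\<forall>(a, \<phi>, \<psi>, \<theta>) \<in> multipliers X S Y Z.
           integrable \<mu> (\<lambda>q. \<phi> q * g q) \<and>
           integrable \<mu> (total_div \<theta>) \<and>
           (\<forall>i. integrable (\<nu> i) (\<lambda>p. \<psi> i p * h i p)) \<and>
           (\<forall>i. integrable (\<nu> i) (flux n \<theta> i)))}"

definition feasible_measures ::
    "(real ^ 'n) set \<Rightarrow> ('s::finite \<Rightarrow> (real ^ 'n) set) \<Rightarrow> ('s \<Rightarrow> real ^ 'n \<Rightarrow> real ^ 'n) \<Rightarrow>
     (real ^ 'm) set \<Rightarrow> (real ^ 'n ^ 'm) set \<Rightarrow>
     (('n, 'm) jet \<Rightarrow> real) \<Rightarrow> (('n, 'm) jet \<Rightarrow> real) \<Rightarrow> (('n, 'm) jet \<Rightarrow> real) \<Rightarrow>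
     ('s \<Rightarrow> ('n, 'm) pt \<Rightarrow> real) \<Rightarrow> ('n, 'm, 's) measure_tuple set" where
  "feasible_measures X S n Y Z l f g h =
     {(\<mu>, \<nu>) \<in> measures_N X S n Y Z l f g h.
        (LINT q|\<mu>. f q) = 0 \<and>
        (\<forall>\<phi>. continuous_on (Omega X Y Z) \<phi> \<longrightarrow> (LINT q|\<mu>. \<phi> q * g q) = 0) \<and>
        (\<forall>i \<psi>. continuous_on (Gam S Y i) \<psi> \<longrightarrow> (LINT p|\<nu> i. \<psi> p * h i p) = 0) \<and>
        (\<forall>\<theta>\<in>C1_maps. (LINT q|\<mu>. total_div \<theta> q) - (\<Sum>i\<in>UNIV. LINT p|\<nu> i. flux n \<theta> i p) = 0)}"


section \<open>The two programs\<close>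

definition primal_value ::
    "(real ^ 'n) set \<Rightarrow> ('s::finite \<Rightarrow> (real ^ 'n) set) \<Rightarrow> ('s \<Rightarrow> real ^ 'n \<Rightarrow> real ^ 'n) \<Rightarrow>
     (real ^ 'm) set \<Rightarrow> (real ^ 'n ^ 'm) set \<Rightarrow>
     (('n, 'm) jet \<Rightarrow> real) \<Rightarrow> (('n, 'm) jet \<Rightarrow> real) \<Rightarrow> (('n, 'm) jet \<Rightarrow> real) \<Rightarrow>
     ('s \<Rightarrow> ('n, 'm) pt \<Rightarrow> real) \<Rightarrow> ereal" where
  "primal_value X S n Y Z l f g h =
     (INF (\<mu>, \<nu>) \<in> feasible_measures X S n Y Z l f g h. ereal (LINT q|\<mu>. l q))"

definition dual_value ::
    "(real ^ 'n) set \<Rightarrow> ('s::finite \<Rightarrow> (real ^ 'n) set) \<Rightarrow> ('s \<Rightarrow> real ^ 'n \<Rightarrow> real ^ 'n) \<Rightarrow>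
     (real ^ 'm) set \<Rightarrow> (real ^ 'n ^ 'm) set \<Rightarrow>
     (('n, 'm) jet \<Rightarrow> real) \<Rightarrow> (('n, 'm) jet \<Rightarrow> real) \<Rightarrow> (('n, 'm) jet \<Rightarrow> real) \<Rightarrow>
     ('s \<Rightarrow> ('n, 'm) pt \<Rightarrow> real) \<Rightarrow> ereal" where
  "dual_value X S n Y Z l f g h =
     (SUP \<Lambda> \<in> multipliers X S Y Z.
        ereal (volume X) * (INF q \<in> Omega X Y Z. ereal (F_fun l f g \<Lambda> q)) +
        (\<Sum>i\<in>UNIV. ereal (area (S i)) * (INF p \<in> Gam S Y i. ereal (G_fun n h \<Lambda> i p))))"

definition lagrangian ::
    "('s::finite \<Rightarrow> real ^ 'n \<Rightarrow> real ^ 'n) \<Rightarrow>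
     (('n::finite, 'm::finite) jet \<Rightarrow> real) \<Rightarrow> (('n, 'm) jet \<Rightarrow> real) \<Rightarrow> (('n, 'm) jet \<Rightarrow> real) \<Rightarrow>
     ('s \<Rightarrow> ('n, 'm) pt \<Rightarrow> real) \<Rightarrow>
     ('n, 'm, 's) measure_tuple \<Rightarrow> ('n, 'm, 's) multiplier \<Rightarrow> real" where
  "lagrangian n l f g h = (\<lambda>(\<mu>, \<nu>) \<Lambda>.
     (LINT q|\<mu>. F_fun l f g \<Lambda> q) + (\<Sum>i\<in>UNIV. LINT p|\<nu> i. G_fun n h \<Lambda> i p))"

end

theory Submission
  imports Defs
begin

text \<open>Integrating \<open>F\<close> and \<open>G\<^sub>i\<close> against a tuple \<open>m\<close> gives a Lagrangian \<open>L m \<Lambda>\<close> that is affine in the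
  multiplier \<open>\<Lambda>\<close>. Its supremum over \<open>\<Lambda>\<close> is therefore \<open>\<langle>l, \<mu>\<rangle>\<close> if \<open>m\<close> satisfies the constraints and
  \<open>\<infinity>\<close> otherwise, while its infimum over \<open>m\<close> is approached by point masses; weak duality follows.

  If \<open>Y\<close> and \<open>Z\<close> are bounded, \<open>\<Omega>\<close> and \<open>\<Gamma>\<^sub>i\<close> are compact, and by Tychonoff's theorem so is the set
  of tuples of positive linear functionals with the prescribed masses. For \<open>b\<close> above the dual value,
  the sets \<open>{m. L m \<Lambda> \<le> b}\<close> have the finite intersection property, because a separating line in the
  plane turns two multipliers into a single one, and induction does the rest. Hence some tuple of
  functionals lies in all of them, and by Riesz representation it consists of measures.\<close>

section \<open>Positive linear functionals on a compact set\<close>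

text \<open>The limit tuple is sought among functionals because a function type carries the product
  topology: evaluation at a fixed test function is continuous, so each Lagrangian, a finite sum of
  such evaluations, is continuous too. Functionals are total and have values even at discontinuous
  functions; the last condition of \<open>pos_functionals\<close> sets these values to 0, since
  otherwise those coordinates would be unbounded and compactness would fail. The remaining
  coordinates are bounded by positivity and the prescribed mass, provided that continuous functions
  on the base set are bounded. This is where compactness of \<open>\<Omega>\<close> and
  \<open>\<Gamma> i\<close> matters; on an unbounded set mass could escape to infinity in the limit.
  The number \<open>b\<close> lies strictly between the two values: strictness on the dual side
  gives each multiplier a tuple with \<open>L < b\<close>, and on the primal side the weak bound
  \<open>L \<le> b\<close> for all multipliers is already a contradiction, also when the primal
  value is infinite.\<close>

definition pos_functionals :: "'a::topological_space set \<Rightarrow> real \<Rightarrow> (('a \<Rightarrow> real) \<Rightarrow> real) set" where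
  "pos_functionals K c =
     {T. (\<forall>u v. continuous_on K u \<longrightarrow> continuous_on K v \<longrightarrow> T (\<lambda>x. u x + v x) = T u + T v) \<and>
         (\<forall>r u. continuous_on K u \<longrightarrow> T (\<lambda>x. r * u x) = r * T u) \<and>
         (\<forall>u. continuous_on K u \<longrightarrow> (\<forall>x\<in>K. 0 \<le> u x) \<longrightarrow> 0 \<le> T u) \<and>
         T (\<lambda>x. 1) = c \<and>
         (\<forall>u. \<not> continuous_on K u \<longrightarrow> T u = 0)}"

context
  fixes K :: "'a::topological_space set" and c :: real and T :: "('a \<Rightarrow> real) \<Rightarrow> real"
  assumes T: "T \<in> pos_functionals K c"
begin

lemma pos_functional_add:
  "continuous_on K u \<Longrightarrow> continuous_on K v \<Longrightarrow> T (\<lambda>x. u x + v x) = T u + T v"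
  using T unfolding pos_functionals_def by blast

lemma pos_functional_cmult: "continuous_on K u \<Longrightarrow> T (\<lambda>x. r * u x) = r * T u"
  using T unfolding pos_functionals_def by blast

lemma pos_functional_nonneg: "continuous_on K u \<Longrightarrow> (\<And>x. x \<in> K \<Longrightarrow> 0 \<le> u x) \<Longrightarrow> 0 \<le> T u"
  using T unfolding pos_functionals_def by blast

lemma pos_functional_one: "T (\<lambda>x. 1) = c"
  using T unfolding pos_functionals_def by blast

lemma pos_functional_const: "T (\<lambda>x. r) = r * c"
  using pos_functional_cmult[of "\<lambda>x. 1" r] by (simp add: pos_functional_one)

lemma pos_functional_diff:
  assumes "continuous_on K u" "continuous_on K v"
  shows "T (\<lambda>x. u x - v x) = T u - T v"
  using pos_functional_add[of u "\<lambda>x. (-1) * v x"] pos_functional_cmult[of v "-1"] assms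
  by (simp add: continuous_on_minus)

lemma pos_functional_mono:
  assumes "continuous_on K u" "continuous_on K v" "\<And>x. x \<in> K \<Longrightarrow> u x \<le> v x"
  shows "T u \<le> T v"
  using pos_functional_nonneg[of "\<lambda>x. v x - u x"] assms
  by (simp add: pos_functional_diff continuous_on_diff)

text \<open>Positivity is tested on \<open>K\<close> only, so monotonicity in both directions shows
  that \<open>T\<close> sees nothing but the restriction to \<open>K\<close>. Extensions off
  \<open>K\<close> may therefore be chosen freely.\<close>

lemma pos_functional_cong:
  assumes "continuous_on K u" "\<And>x. x \<in> K \<Longrightarrow> u x = v x"
  shows "T u = T v"
proof -
  have "continuous_on K v"
    using assms continuous_on_cong by metis
  then show ?thesis
    using assms pos_functional_mono[of u v] pos_functional_mono[of v u] by fastforce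
qed

lemma pos_functional_sum:
  assumes "finite I" "\<And>i. i \<in> I \<Longrightarrow> continuous_on K (u i)"
  shows "T (\<lambda>x. \<Sum>i\<in>I. u i x) = (\<Sum>i\<in>I. T (u i))"
  using assms
proof (induction I)
  case empty
  show ?case using pos_functional_const[of 0] by simp
next
  case (insert i I)
  then show ?case by (simp add: pos_functional_add continuous_on_sum)
qed

lemma pos_functional_mass_nonneg: "0 \<le> c"
  using pos_functional_nonneg[of "\<lambda>x. 1"] pos_functional_one by simp

end

section \<open>Riesz representation: the measure generated by a positive functional\<close>

lemma infdist_Compl_pos_iff:
  assumes "open U" "U \<noteq> UNIV"
  shows "0 < infdist x (- U) \<longleftrightarrow> x \<in> U"
  using in_closed_iff_infdist_zero[of "- U" x] infdist_nonneg[of x "- U"] assms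
  by (metis Compl_eq_Diff_UNIV ComplI ComplD closed_Compl diff_shunt_var less_le top.extremum_uniqueI)

text \<open>Vanishing off \<open>U\<close> replaces the usual compact support inside
  \<open>U\<close>. Where compactness is wanted, it is recovered by cutting a bump off at a small
  height \<open>d\<close>.\<close>

definition bump_functions :: "'a::topological_space set \<Rightarrow> ('a \<Rightarrow> real) set" where
  "bump_functions U =
     {u. continuous_on UNIV u \<and> (\<forall>x. 0 \<le> u x \<and> u x \<le> 1) \<and> (\<forall>x. x \<notin> U \<longrightarrow> u x = 0)}"

text \<open>The content of open sets in the Riesz-Markov construction; \<open>riesz_outer\<close>
  extends it to all sets by outer regularity.\<close>

definition riesz_open :: "(('a::topological_space \<Rightarrow> real) \<Rightarrow> real) \<Rightarrow> 'a set \<Rightarrow> ennreal" where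
  "riesz_open T U = (SUP u\<in>bump_functions U. ennreal (T u))"

definition riesz_outer :: "(('a::topological_space \<Rightarrow> real) \<Rightarrow> real) \<Rightarrow> 'a set \<Rightarrow> ennreal" where
  "riesz_outer T A = (INF U\<in>{U. open U \<and> A \<subseteq> U}. riesz_open T U)"

lemma zero_bump_function: "(\<lambda>x. 0) \<in> bump_functions U"
  by (simp add: bump_functions_def)

lemma riesz_open_mono: "U \<subseteq> V \<Longrightarrow> riesz_open T U \<le> riesz_open T V"
  unfolding riesz_open_def by (rule SUP_subset_mono) (auto simp: bump_functions_def)

lemma riesz_outer_open: "open U \<Longrightarrow> riesz_outer T U = riesz_open T U"
  unfolding riesz_outer_def
  by (rule antisym) (auto intro!: INF_lower INF_greatest riesz_open_mono)

lemma riesz_outer_mono: "A \<subseteq> B \<Longrightarrow> riesz_outer T A \<le> riesz_outer T B"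
  unfolding riesz_outer_def by (rule INF_superset_mono) auto

context
  fixes K :: "'a::euclidean_space set" and c :: real and T :: "('a \<Rightarrow> real) \<Rightarrow> real"
  assumes K: "compact K" and T: "T \<in> pos_functionals K c"
begin

lemma bump_continuous: "u \<in> bump_functions U \<Longrightarrow> continuous_on K u"
  by (auto simp: bump_functions_def intro: continuous_on_subset)

lemma bump_functional_nonneg: "u \<in> bump_functions U \<Longrightarrow> 0 \<le> T u"
  by (rule pos_functional_nonneg[OF T bump_continuous]) (auto simp: bump_functions_def)

lemma riesz_open_upper: "u \<in> bump_functions U \<Longrightarrow> ennreal (T u) \<le> riesz_open T U"
  unfolding riesz_open_def by (rule SUP_upper)

lemma riesz_open_UNIV: "riesz_open T UNIV = ennreal c"
proof (rule antisym)
  show "riesz_open T UNIV \<le> ennreal c"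
    unfolding riesz_open_def
  proof (rule SUP_least)
    fix u :: "'a \<Rightarrow> real" assume u: "u \<in> bump_functions UNIV"
    then have "T u \<le> T (\<lambda>x. 1)"
      by (intro pos_functional_mono[OF T] bump_continuous) (auto simp: bump_functions_def)
    then show "ennreal (T u) \<le> ennreal c"
      by (simp add: pos_functional_one[OF T] ennreal_leI)
  qed
  show "ennreal c \<le> riesz_open T UNIV"
    using riesz_open_upper[of "\<lambda>x. 1" UNIV]
    by (simp add: pos_functional_one[OF T] bump_functions_def)
qed

lemma riesz_open_finite: "riesz_open T U < \<infinity>"
  using riesz_open_mono[of U UNIV T] riesz_open_UNIV by (auto simp: less_top[symmetric] top_unique)

lemma riesz_open_Compl: "riesz_open T (- K) = 0"
proof -
  have "T u = 0" if "u \<in> bump_functions (- K)" for u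
    using pos_functional_cong[OF T bump_continuous[OF that], of "\<lambda>x. 0"] that
      pos_functional_const[OF T, of 0] by (auto simp: bump_functions_def)
  then have "riesz_open T (- K) \<le> 0"
    unfolding riesz_open_def by (intro SUP_least) simp
  then show ?thesis by simp
qed

lemma riesz_open_empty: "riesz_open T {} = 0"
  using riesz_open_mono[of "{}" "- K" T] riesz_open_Compl by simp

lemma bump_approx:
  assumes "0 < (e::real)"
  obtains u where "u \<in> bump_functions U" "riesz_open T U \<le> ennreal (T u + e)"
proof (cases "riesz_open T U = 0")
  \<comment> \<open>Subtraction in \<open>ennreal\<close> stops at 0, so the strict inequality of
    the other case requires a nonzero value.\<close>
  case True
  with that[OF zero_bump_function] assms pos_functional_const[OF T, of 0] show ?thesis by simp
next
  case False
  have "riesz_open T U - ennreal e < riesz_open T U"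
    using riesz_open_finite[of U] False assms ennreal_between(1)[of "ennreal e"]
    by (simp add: less_top[symmetric] zero_less_iff_neq_zero)
  then obtain u where u: "u \<in> bump_functions U" "riesz_open T U - ennreal e < ennreal (T u)"
    unfolding riesz_open_def[of T U] less_SUP_iff by blast
  then have "riesz_open T U \<le> ennreal (T u) + ennreal e"
    by (metis add.commute ennreal_minus_le_iff order.order_iff_strict)
  then show ?thesis
    using that[OF u(1)] bump_functional_nonneg[OF u(1)] assms by (simp add: ennreal_plus)
qed

text \<open>Cutting \<open>u\<close> down to \<open>max 0 (u - d)\<close> costs at most \<open>d * c\<close>, and moves its support into the
  closed set \<open>{d \<le> u}\<close>.\<close>

lemma pos_functional_cutoff:
  assumes "continuous_on K u"
  shows "T u \<le> T (\<lambda>x. max 0 (u x - d)) + d * c"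
proof -
  have "T u \<le> T (\<lambda>x. max 0 (u x - d) + d)"
    by (rule pos_functional_mono[OF T]) (auto intro!: continuous_intros assms)
  also have "\<dots> = T (\<lambda>x. max 0 (u x - d)) + d * c"
    using pos_functional_const[OF T, of d]
    by (subst pos_functional_add[OF T]) (auto intro!: continuous_intros assms)
  finally show ?thesis .
qed

text \<open>A partition of unity for the truncated function: on \<open>K\<close> it lives on the
  compact set \<open>{d \<le> u}\<close>, which finitely many \<open>U k\<close> cover, and is
  shared out there in proportion to the distances to the complements.\<close>

lemma bump_subordinate:
  assumes U: "\<And>k::nat. open (U k)" and u: "u \<in> bump_functions (\<Union>k. U k)" and d: "0 < (d::real)"
  obtains n v where "\<And>k. k < n \<Longrightarrow> v k \<in> bump_functions (U k)"
    "\<And>x. x \<in> K \<Longrightarrow> max 0 (u x - d) = (\<Sum>k<n. v k x)"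
proof -
  have contu: "continuous_on UNIV u" and u0: "\<And>x. x \<notin> (\<Union>k. U k) \<Longrightarrow> u x = 0"
    and u1: "\<And>x. 0 \<le> u x" "\<And>x. u x \<le> 1"
    using u by (auto simp: bump_functions_def)
  define C where "C = K \<inter> {x. d \<le> u x}"
  have "closed {x. d \<le> u x}"
    using contu by (intro closed_Collect_le) auto
  then have C: "compact C"
    unfolding C_def using K by blast
  have "C \<subseteq> (\<Union>k. U k)"
    using u0 d unfolding C_def by fastforce
  then obtain D where D: "finite D" "C \<subseteq> (\<Union>k\<in>D. U k)"
    using compactE_image[OF C, of UNIV U] U by auto
  obtain n where n: "D \<subseteq> {..<n}"
    using finite_nat_iff_bounded D(1) by blast
  \<comment> \<open>The distance to the empty set is 0 by convention, hence the separate value for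
    \<open>U k = UNIV\<close>.\<close>
  define g where "g k x = (if U k = UNIV then 1 else infdist x (- U k))" for k x
  have g_cont: "continuous_on A (g k)" for k A
    unfolding g_def by (cases "U k = UNIV") (auto intro!: continuous_intros)
  have g_nonneg: "0 \<le> g k x" for k x
    by (simp add: g_def infdist_nonneg)
  have g_pos: "0 < g k x \<longleftrightarrow> x \<in> U k" for k x
    using infdist_Compl_pos_iff[OF U, of k x] by (auto simp: g_def)
  define s where "s x = (\<Sum>k<n. g k x)" for x
  have s_cont: "continuous_on A s" for A
    unfolding s_def by (intro continuous_intros g_cont)
  have s_pos: "0 < s x" if x: "x \<in> C" for x
  proof -
    obtain k where "k < n" "x \<in> U k"
      using D n x by blast
    then show ?thesis
      unfolding s_def using g_nonneg g_pos by (intro sum_pos2[of _ k]) auto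
  qed
  obtain \<eta> where \<eta>: "0 < \<eta>" "\<And>x. x \<in> C \<Longrightarrow> \<eta> \<le> s x"
  proof (cases "C = {}")
    case True
    then show ?thesis using that[of 1] by simp
  next
    case False
    then obtain x where "x \<in> C" "\<forall>y\<in>C. s x \<le> s y"
      using continuous_attains_inf[OF C False s_cont] by blast
    then show ?thesis using that[of "s x"] s_pos by auto
  qed
  \<comment> \<open>The bound \<open>\<eta>\<close> keeps the denominator positive everywhere, so
    \<open>v k\<close> is continuous on the whole space. On \<open>C\<close> the denominator is
    still \<open>s x\<close>, and on the rest of \<open>K\<close> the first factor is 0.\<close>
  define v where "v k x = max 0 (u x - d) * (g k x / max \<eta> (s x))" for k x
  have max_pos: "0 < max \<eta> (s x)" for x
    using \<eta> by simp
  show ?thesis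
  proof
    fix k assume k: "k < n"
    have "g k x \<le> s x" for x
      unfolding s_def using k g_nonneg by (intro member_le_sum) auto
    then have quot: "g k x / max \<eta> (s x) \<le> 1" for x
      using max_pos[of x] by (simp add: le_max_iff_disj)
    have "continuous_on UNIV (v k)"
      unfolding v_def using max_pos
      by (intro continuous_intros contu g_cont s_cont) (metis less_irrefl)
    moreover have "0 \<le> v k x" for x
      unfolding v_def using max_pos[of x] g_nonneg by simp
    moreover have "v k x \<le> 1" for x
    proof -
      have "max 0 (u x - d) \<le> 1" using u1[of x] d by auto
      then show ?thesis unfolding v_def using quot[of x] max_pos[of x] g_nonneg[of k x]
        by (intro mult_le_one) auto
    qed
    moreover have "v k x = 0" if "x \<notin> U k" for x
      using g_pos[of k x] g_nonneg[of k x] that unfolding v_def by auto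
    ultimately show "v k \<in> bump_functions (U k)"
      by (simp add: bump_functions_def)
  next
    fix x assume x: "x \<in> K"
    show "max 0 (u x - d) = (\<Sum>k<n. v k x)"
    proof (cases "d \<le> u x")
      case True
      then have "max \<eta> (s x) = s x" "0 < s x"
        using x \<eta> s_pos by (auto simp: C_def max_def)
      then show ?thesis
        unfolding v_def by (simp add: s_def[symmetric] sum_distrib_left[symmetric] sum_divide_distrib[symmetric])
    qed (simp add: v_def max_def)
  qed
qed

lemma riesz_open_countably_subadditive:
  assumes U: "\<And>k::nat. open (U k)"
  shows "riesz_open T (\<Union>k. U k) \<le> (\<Sum>k. riesz_open T (U k))"
  unfolding riesz_open_def[of T "\<Union>k. U k"]
proof (rule SUP_least, rule ennreal_le_epsilon)
  fix u and e :: real assume u: "u \<in> bump_functions (\<Union>k. U k)" and e: "0 < e"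
  have c: "0 \<le> c" by (rule pos_functional_mass_nonneg[OF T])
  \<comment> \<open>The truncation costs \<open>d * c\<close>, which must not exceed
    \<open>e\<close>; adding 1 admits \<open>c = 0\<close>.\<close>
  define d where "d = e / (c + 1)"
  have d: "0 < d" "d * c \<le> e"
    using e c by (auto simp: d_def field_simps)
  obtain n v where v: "\<And>k. k < n \<Longrightarrow> v k \<in> bump_functions (U k)"
    and uv: "\<And>x. x \<in> K \<Longrightarrow> max 0 (u x - d) = (\<Sum>k<n. v k x)"
    using bump_subordinate[OF U u d(1)] by blast
  have "T u \<le> T (\<lambda>x. max 0 (u x - d)) + d * c"
    by (rule pos_functional_cutoff[OF bump_continuous[OF u]])
  also have "T (\<lambda>x. max 0 (u x - d)) = T (\<lambda>x. \<Sum>k<n. v k x)"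
    by (rule pos_functional_cong[OF T _ uv]) (intro continuous_intros bump_continuous[OF u])
  also have "\<dots> = (\<Sum>k<n. T (v k))"
    by (rule pos_functional_sum[OF T]) (auto intro: bump_continuous v)
  finally have "ennreal (T u) \<le> ennreal ((\<Sum>k<n. T (v k)) + e)"
    using d by (intro ennreal_leI) simp
  also have "\<dots> = (\<Sum>k<n. ennreal (T (v k))) + ennreal e"
    using e v bump_functional_nonneg by (subst ennreal_plus) (auto intro!: sum_nonneg sum_ennreal[symmetric])
  also have "(\<Sum>k<n. ennreal (T (v k))) \<le> (\<Sum>k<n. riesz_open T (U k))"
    using v by (intro sum_mono riesz_open_upper) auto
  also have "\<dots> \<le> (\<Sum>k. riesz_open T (U k))"
    by (intro sum_le_suminf) auto
  finally show "ennreal (T u) \<le> (\<Sum>k. riesz_open T (U k)) + ennreal e" by simp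
qed

lemma riesz_outer_countably_subadditive:
  "riesz_outer T (\<Union>k. A k) \<le> (\<Sum>k::nat. riesz_outer T (A k))"
proof (rule ennreal_le_epsilon)
  fix e :: real assume e: "0 < e"
  have "\<exists>U. open U \<and> A k \<subseteq> U \<and> riesz_open T U \<le> riesz_outer T (A k) + ennreal (e * (1/2) ^ Suc k)" for k
  proof -
    have "riesz_outer T (A k) < riesz_outer T (A k) + ennreal (e * (1/2) ^ Suc k)"
    proof -
      have "riesz_outer T (A k) \<le> riesz_open T UNIV"
        by (metis riesz_outer_mono riesz_outer_open open_UNIV subset_UNIV)
      then have "riesz_outer T (A k) < top"
        using riesz_open_finite[of UNIV] by (simp add: order_le_less_trans)
      then show ?thesis using e
        by (metis add.right_neutral ennreal_add_left_cancel_less ennreal_less_zero_iff infinity_ennreal_def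
            less_irrefl mult_pos_pos zero_less_divide_1_iff zero_less_numeral zero_less_power)
    qed
    then show ?thesis
      unfolding riesz_outer_def[of T "A k"] INF_less_iff by (auto intro: less_imp_le)
  qed
  then obtain U where U: "\<And>k. open (U k)" "\<And>k. A k \<subseteq> U k"
    "\<And>k. riesz_open T (U k) \<le> riesz_outer T (A k) + ennreal (e * (1/2) ^ Suc k)"
    by metis
  have "riesz_outer T (\<Union>k. A k) \<le> riesz_outer T (\<Union>k. U k)"
    using U(2) by (intro riesz_outer_mono) blast
  also have "\<dots> = riesz_open T (\<Union>k. U k)"
    using U(1) by (intro riesz_outer_open) blast
  also have "\<dots> \<le> (\<Sum>k. riesz_open T (U k))"
    by (rule riesz_open_countably_subadditive[OF U(1)])
  also have "\<dots> \<le> (\<Sum>k. riesz_outer T (A k) + ennreal (e * (1/2) ^ Suc k))"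
    by (intro suminf_le U(3)) auto
  also have "\<dots> = (\<Sum>k. riesz_outer T (A k)) + (\<Sum>k. ennreal (e * (1/2) ^ Suc k))"
    by (rule suminf_add[symmetric]) auto
  also have "(\<Sum>k. ennreal (e * (1/2) ^ Suc k)) = ennreal e"
    using e sums_mult[OF power_half_series, of e]
    by (intro suminf_ennreal_eq) auto
  finally show "riesz_outer T (\<Union>k. A k) \<le> (\<Sum>k. riesz_outer T (A k)) + ennreal e" .
qed

text \<open>This is the nontrivial half of Caratheodory's criterion, for open test sets. Nearly
  optimal bumps for \<open>W \<inter> U\<close> and for a neighbourhood of \<open>W - U\<close> can
  be added without exceeding 1 once the first is truncated so that the two no longer
  overlap.\<close>

lemma riesz_open_split:
  assumes "open U" "open W"
  shows "riesz_outer T (W \<inter> U) + riesz_outer T (W - U) \<le> riesz_open T W"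
proof (rule ennreal_le_epsilon)
  fix e :: real assume e: "0 < e"
  have c: "0 \<le> c" by (rule pos_functional_mass_nonneg[OF T])
  \<comment> \<open>The error \<open>e\<close> is spent in thirds: two approximations by bumps and
    one truncation.\<close>
  define d where "d = e / (3 * (c + 1))"
  have d: "0 < d" "d * c \<le> e / 3"
    using e c by (auto simp: d_def field_simps)
  obtain u where u: "u \<in> bump_functions (W \<inter> U)" "riesz_open T (W \<inter> U) \<le> ennreal (T u + e/3)"
    using bump_approx[of "e/3" "W \<inter> U"] e by auto
  have contu: "continuous_on UNIV u" and u01: "\<And>x. 0 \<le> u x" "\<And>x. u x \<le> 1"
    and u0: "\<And>x. x \<notin> W \<inter> U \<Longrightarrow> u x = 0"
    using u(1) by (auto simp: bump_functions_def)
  \<comment> \<open>\<open>V\<close> is open and contains \<open>W - U\<close>, because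
    \<open>u\<close> vanishes off \<open>U\<close>; the truncation of \<open>u\<close> at height
    \<open>d\<close> is 0 on \<open>V\<close>.\<close>
  define V where "V = W \<inter> {x. u x < d}"
  have V: "open V"
    unfolding V_def using contu assms by (intro open_Int open_Collect_less) auto
  obtain v where v: "v \<in> bump_functions V" "riesz_open T V \<le> ennreal (T v + e/3)"
    using bump_approx[of "e/3" V] e by auto
  define w where "w x = max 0 (u x - d) + v x" for x
  have wW: "w \<in> bump_functions W"
  proof -
    have "continuous_on UNIV w"
      unfolding w_def using v(1) by (intro continuous_intros contu) (auto simp: bump_functions_def)
    moreover have "0 \<le> w x \<and> w x \<le> 1 \<and> (x \<notin> W \<longrightarrow> w x = 0)" for x
    proof (cases "x \<in> V")
      case True
      then show ?thesis using v(1) by (auto simp: w_def V_def bump_functions_def)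
    next
      case False
      then have "v x = 0" using v(1) by (auto simp: bump_functions_def)
      then show ?thesis using u01[of x] u0[of x] d by (auto simp: w_def)
    qed
    ultimately show ?thesis by (simp add: bump_functions_def)
  qed
  have "riesz_outer T (W \<inter> U) \<le> ennreal (T u + e/3)"
    using u(2) assms by (simp add: riesz_outer_open open_Int)
  moreover have "riesz_outer T (W - U) \<le> ennreal (T v + e/3)"
  proof -
    have "W - U \<subseteq> V" using u0 d by (auto simp: V_def)
    then have "riesz_outer T (W - U) \<le> riesz_outer T V" by (rule riesz_outer_mono)
    then show ?thesis using v(2) V by (simp add: riesz_outer_open)
  qed
  ultimately have "riesz_outer T (W \<inter> U) + riesz_outer T (W - U) \<le> ennreal (T u + e/3) + ennreal (T v + e/3)"
    by (rule add_mono)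
  also have "\<dots> = ennreal ((T u + e/3) + (T v + e/3))"
    using bump_functional_nonneg[OF u(1)] bump_functional_nonneg[OF v(1)] e
    by (intro ennreal_plus[symmetric]) auto
  also have "\<dots> \<le> ennreal (T w + e)"
  proof (rule ennreal_leI)
    have "T w = T (\<lambda>x. max 0 (u x - d)) + T v"
      unfolding w_def
      by (intro pos_functional_add[OF T]) (intro continuous_intros bump_continuous[OF u(1)] bump_continuous[OF v(1)])+
    then show "(T u + e/3) + (T v + e/3) \<le> T w + e"
      using pos_functional_cutoff[OF bump_continuous[OF u(1)], of d] d by simp
  qed
  also have "ennreal (T w + e) = ennreal (T w) + ennreal e"
    using bump_functional_nonneg[OF wW] e by (intro ennreal_plus) auto
  also have "\<dots> \<le> riesz_open T W + ennreal e"
    by (intro add_right_mono riesz_open_upper wW)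
  finally show "riesz_outer T (W \<inter> U) + riesz_outer T (W - U) \<le> riesz_open T W + ennreal e" .
qed

text \<open>The lambda system consists of the Caratheodory measurable sets. An arbitrary test set is
  replaced by its open supersets, over which \<open>riesz_outer\<close> is an infimum.\<close>

lemma open_in_riesz_lambda_system:
  assumes "open U"
  shows "U \<in> lambda_system UNIV (Pow UNIV) (riesz_outer T)"
proof -
  have "riesz_outer T (U \<inter> A) + riesz_outer T (- U \<inter> A) = riesz_outer T A" for A
  proof (rule antisym)
    show "riesz_outer T (U \<inter> A) + riesz_outer T (- U \<inter> A) \<le> riesz_outer T A"
      unfolding riesz_outer_def[of T A]
    proof (rule INF_greatest)
      fix W assume W: "W \<in> {W. open W \<and> A \<subseteq> W}"
      then have "riesz_outer T (U \<inter> A) + riesz_outer T (- U \<inter> A)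
          \<le> riesz_outer T (W \<inter> U) + riesz_outer T (W - U)"
        by (intro add_mono riesz_outer_mono) auto
      also have "\<dots> \<le> riesz_open T W"
        using W assms by (intro riesz_open_split) auto
      finally show "riesz_outer T (U \<inter> A) + riesz_outer T (- U \<inter> A) \<le> riesz_open T W" .
    qed
    have "riesz_outer T A = riesz_outer T (\<Union>k. binaryset (U \<inter> A) (- U \<inter> A) k)"
      by (simp add: UN_binaryset_eq Int_Un_distrib2[symmetric])
    also have "\<dots> \<le> (\<Sum>k. riesz_outer T (binaryset (U \<inter> A) (- U \<inter> A) k))"
      by (rule riesz_outer_countably_subadditive)
    also have "\<dots> = riesz_outer T (U \<inter> A) + riesz_outer T (- U \<inter> A)"
      by (rule suminf_binaryset_eq) (simp add: riesz_outer_open riesz_open_empty)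
    finally show "riesz_outer T A \<le> riesz_outer T (U \<inter> A) + riesz_outer T (- U \<inter> A)" .
  qed
  then show ?thesis
    by (simp add: lambda_system_def Compl_eq_Diff_UNIV[symmetric])
qed

text \<open>Caratheodory's lemma makes the lambda system a sigma-algebra on which the outer measure
  is countably additive; containing the open sets, it contains the Borel sets.\<close>

lemma riesz_measure_exists:
  obtains M :: "'a measure" where "sets M = sets borel" "\<And>U. open U \<Longrightarrow> emeasure M U = riesz_open T U"
proof -
  let ?L = "lambda_system UNIV (Pow UNIV) (riesz_outer T)"
  have "outer_measure_space (Pow UNIV) (riesz_outer T)"
    unfolding outer_measure_space_def positive_def increasing_def countably_subadditive_def
    by (auto simp: riesz_outer_open riesz_open_empty
        intro: riesz_outer_mono riesz_outer_countably_subadditive)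
  then have L: "measure_space UNIV ?L (riesz_outer T)"
    using sigma_algebra.caratheodory_lemma[OF sigma_algebra_Pow] by metis
  then interpret L: sigma_algebra UNIV ?L
    by (simp add: measure_space_def)
  have "sets borel \<subseteq> ?L"
    unfolding sets_borel using open_in_riesz_lambda_system by (intro L.sigma_sets_subset) auto
  then have ms: "measure_space UNIV (sets borel) (riesz_outer T)"
    using L sets.sigma_algebra_axioms[of "borel :: 'a measure"]
    by (auto simp: measure_space_def positive_def countably_additive_def subset_eq)
  define M :: "'a measure" where "M = measure_of UNIV (sets borel) (riesz_outer T)"
  have "sets M = sets borel"
    unfolding M_def using sets.sets_measure_of_eq[of "borel :: 'a measure"] by simp
  moreover have "emeasure M U = riesz_open T U" if "open U" for U
  proof -
    have "emeasure M U = riesz_outer T U"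
      unfolding M_def using ms that
      by (intro emeasure_measure_of_sigma) (auto simp: measure_space_def)
    then show ?thesis using that by (simp add: riesz_outer_open)
  qed
  ultimately show ?thesis using that by blast
qed

text \<open>Slicing \<open>u\<close> into \<open>N\<close> layers of height \<open>1/N\<close>, the \<open>j\<close>-th slice of \<open>T u\<close> is at most
  \<open>M {j/N < u} / N\<close>, which is at most the integral of the preceding slice.\<close>

lemma pos_functional_le_integral:
  fixes M :: "'a measure"
  assumes M: "sets M = sets borel" "\<And>U. open U \<Longrightarrow> emeasure M U = riesz_open T U"
    and u: "u \<in> bump_functions UNIV"
  shows "T u \<le> (LINT x|M. u x)"
proof -
  have contu: "continuous_on UNIV u" and u01: "\<And>x. 0 \<le> u x" "\<And>x. u x \<le> 1"
    using u by (auto simp: bump_functions_def)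
  have c: "0 \<le> c" by (rule pos_functional_mass_nonneg[OF T])
  have space: "space M = UNIV"
    using sets_eq_imp_space_eq[OF M(1)] by simp
  have mass: "emeasure M UNIV = ennreal c"
    by (simp add: M(2) riesz_open_UNIV)
  interpret M: finite_measure M
    by (rule finite_measureI) (simp add: space mass)
  have meas: "measure M UNIV = c"
    using mass c by (simp add: measure_def)
  have int_cont: "integrable M w" if "continuous_on UNIV w" "\<And>x. \<bar>w x\<bar> \<le> 1" for w :: "'a \<Rightarrow> real"
  proof (rule M.integrable_const_bound[of _ 1])
    show "w \<in> borel_measurable M"
      using that borel_measurable_continuous_onI measurable_cong_sets[OF M(1) refl] by blast
  qed (use that in auto)
  have bound: "T u \<le> (LINT x|M. u x) + c / real N" if N: "0 < N" for N :: nat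
  proof -
    \<comment> \<open>The slice \<open>b j\<close> is 0 off \<open>A j\<close>, which bounds
      \<open>T (b j)\<close> from above by the measure of \<open>A j\<close>, and 1 on
      \<open>A (Suc j)\<close>, which bounds its integral from below.\<close>
    define b where "b j x = max 0 (min 1 (real N * u x - real j))" for j x
    define A where "A j = {x. real j < real N * u x}" for j
    have b_cont: "continuous_on UNIV (b j)" for j
      unfolding b_def by (intro continuous_intros contu)
    have A: "open (A j)" for j
      unfolding A_def by (intro open_Collect_less continuous_intros contu)
    have b_bump: "b j \<in> bump_functions (A j)" for j
      using b_cont by (auto simp: bump_functions_def b_def A_def)
    have sum_b: "(\<Sum>j<m. b j x) = min (real m) (real N * u x)" for m x
    proof (induction m)
      case 0
      then show ?case using u01(1)[of x] by simp
    next
      case (Suc m)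
      then show ?case by (auto simp: b_def min_def max_def)
    qed
    have slices: "u x = (1 / real N) * (\<Sum>j<N. b j x)" for x
      using N u01(2)[of x] by (simp add: sum_b min_def mult_le_cancel_left1)
    have "T u = (1 / real N) * (\<Sum>j<N. T (b j))"
    proof -
      have "T u = T (\<lambda>x. (1 / real N) * (\<Sum>j<N. b j x))"
        using slices by (metis ext)
      also have "\<dots> = (1 / real N) * T (\<lambda>x. \<Sum>j<N. b j x)"
        by (rule pos_functional_cmult[OF T]) (intro continuous_intros bump_continuous[OF b_bump])
      also have "T (\<lambda>x. \<Sum>j<N. b j x) = (\<Sum>j<N. T (b j))"
        by (rule pos_functional_sum[OF T]) (auto intro: bump_continuous[OF b_bump])
      finally show ?thesis .
    qed
    moreover have "(\<Sum>j<N. T (b j)) \<le> (\<Sum>j<N. measure M (A j))"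
    proof (rule sum_mono)
      fix j
      have "ennreal (T (b j)) \<le> ennreal (measure M (A j))"
        using riesz_open_upper[OF b_bump, of j] M(2)[OF A] by (simp add: M.emeasure_eq_measure)
      then show "T (b j) \<le> measure M (A j)" by simp
    qed
    \<comment> \<open>The level set \<open>A 0\<close> has no preceding slice and is estimated by
      the total mass \<open>c\<close>; after division by \<open>N\<close> this becomes the error
      \<open>c / N\<close>.\<close>
    moreover have "(\<Sum>j<N. measure M (A j)) \<le> c + real N * (LINT x|M. u x)"
    proof -
      obtain m where m: "N = Suc m" using N gr0_implies_Suc by blast
      have "measure M (A (Suc j)) \<le> (LINT x|M. b j x)" for j
      proof -
        have "measure M (A (Suc j)) = (LINT x|M. indicator (A (Suc j)) x)"
          using A M(1) by (simp add: space)
        also have "\<dots> \<le> (LINT x|M. b j x)"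
        proof (rule integral_mono)
          show "integrable M (indicator (A (Suc j)) :: 'a \<Rightarrow> real)"
            using A M(1) by (simp add: M.emeasure_eq_measure)
          show "integrable M (b j)"
            by (rule int_cont[OF b_cont]) (simp add: b_def)
        qed (auto simp: A_def b_def indicator_def)
        finally show ?thesis .
      qed
      then have "(\<Sum>j<m. measure M (A (Suc j))) \<le> (\<Sum>j<m. LINT x|M. b j x)"
        by (rule sum_mono)
      also have "\<dots> \<le> (\<Sum>j<N. LINT x|M. b j x)"
        unfolding m by (auto simp: b_def)
      also have "\<dots> = (LINT x|M. (\<Sum>j<N. b j x))"
        by (rule Bochner_Integration.integral_sum[symmetric])
           (rule int_cont[OF b_cont], simp add: b_def)
      also have "\<dots> = (LINT x|M. real N * u x)"
        using N slices by (intro Bochner_Integration.integral_cong) auto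
      finally have "(\<Sum>j<m. measure M (A (Suc j))) \<le> real N * (LINT x|M. u x)" by simp
      moreover have "measure M (A 0) \<le> c"
        using M.bounded_measure[of "A 0"] meas space by simp
      ultimately show ?thesis
        unfolding m sum.lessThan_Suc_shift by simp
    qed
    ultimately have "T u \<le> (1 / real N) * (c + real N * (LINT x|M. u x))"
      using N by (auto intro!: mult_left_mono simp: divide_right_mono elim: order_trans)
    then show ?thesis using N by (simp add: field_simps)
  qed
  show ?thesis
  proof (rule field_le_epsilon)
    fix e :: real assume e: "0 < e"
    obtain N :: nat where N: "c / e < real N" using reals_Archimedean2 by blast
    then have "0 < N" using c e by (cases N) (auto simp: field_simps not_less)
    moreover from this have "c / real N \<le> e" using N e by (simp add: field_simps)
    ultimately show "T u \<le> (LINT x|M. u x) + e" using bound[of N] by linarith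
  qed
qed

text \<open>The one-sided estimate for bump functions suffices: applied to \<open>1 - u\<close> it
  gives the reverse inequality, since \<open>T\<close> and the integral agree on constants. Tietze
  extension and an affine rescaling reduce any continuous function on \<open>K\<close> to a bump
  function.\<close>

theorem riesz_representation_compact:
  obtains M :: "'a measure" where "sets M = sets (restrict_space borel K)" "emeasure M K = ennreal c"
    "\<And>u. continuous_on K u \<Longrightarrow> integrable M u \<and> (LINT x|M. u x) = T u"
proof -
  obtain M :: "'a measure" where M: "sets M = sets borel" "\<And>U. open U \<Longrightarrow> emeasure M U = riesz_open T U"
    using riesz_measure_exists by blast
  have c: "0 \<le> c" by (rule pos_functional_mass_nonneg[OF T])
  have space: "space M = UNIV"
    using sets_eq_imp_space_eq[OF M(1)] by simp
  have mass: "emeasure M UNIV = ennreal c"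
    by (simp add: M(2) riesz_open_UNIV)
  interpret M: finite_measure M
    by (rule finite_measureI) (simp add: space mass)
  have meas: "measure M UNIV = c"
    using mass c by (simp add: measure_def)
  have Kclosed: "closed K" using K by (rule compact_imp_closed)
  have K_sets: "K \<inter> space M \<in> sets M"
    using Kclosed M(1) space by simp
  have "- K \<in> null_sets M"
    using Kclosed M riesz_open_Compl by (auto simp: null_sets_def open_Compl)
  then have AE_K: "AE x in M. x \<in> K"
    by (rule AE_I') auto
  have int_cont: "integrable M w" if "continuous_on UNIV w" "\<And>x. \<bar>w x\<bar> \<le> B" for w :: "'a \<Rightarrow> real" and B
  proof (rule M.integrable_const_bound[of _ B])
    show "w \<in> borel_measurable M"
      using that borel_measurable_continuous_onI measurable_cong_sets[OF M(1) refl] by blast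
  qed (use that in auto)
  have bump_eq: "(LINT x|M. u x) = T u" if u: "u \<in> bump_functions UNIV" for u
  proof (rule antisym)
    have u': "(\<lambda>x. 1 - u x) \<in> bump_functions UNIV"
      using u by (auto simp: bump_functions_def intro!: continuous_intros)
    have "T (\<lambda>x. 1 - u x) \<le> (LINT x|M. (1 - u x))"
      by (rule pos_functional_le_integral[OF M u'])
    moreover have "T (\<lambda>x. 1 - u x) = c - T u"
      by (subst pos_functional_diff[OF T]) (auto simp: pos_functional_one[OF T] bump_continuous[OF u])
    moreover have "(LINT x|M. (1 - u x)) = c - (LINT x|M. u x)"
      using u int_cont[of u 1] by (simp add: bump_functions_def meas space)
    ultimately show "(LINT x|M. u x) \<le> T u" by simp
    show "T u \<le> (LINT x|M. u x)"
      by (rule pos_functional_le_integral[OF M u])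
  qed
  have repr: "integrable (restrict_space M K) u \<and> (LINT x|restrict_space M K. u x) = T u"
    if u: "continuous_on K u" for u
  proof -
    have "bounded (u ` K)"
      using compact_continuous_image[OF u K] compact_imp_bounded by blast
    then obtain B where B: "0 < B" "\<And>x. x \<in> K \<Longrightarrow> norm (u x) \<le> B"
      unfolding bounded_pos by auto
    obtain w where w: "continuous_on UNIV w" "\<And>x. x \<in> K \<Longrightarrow> w x = u x" "\<And>x. norm (w x) \<le> B"
      using Tietze[OF u, of UNIV B] B Kclosed by auto
    \<comment> \<open>This maps the range \<open>{-B..B}\<close> of the extension \<open>w\<close>
      onto \<open>{0..1}\<close>.\<close>
    define v where "v x = (w x + B) / (2 * B)" for x
    have v: "v \<in> bump_functions UNIV"
      using w B unfolding bump_functions_def v_def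
      by (auto intro!: continuous_intros simp: abs_le_iff field_simps) (smt (verit))+
    have w_v: "w x = 2 * B * v x - B" for x
      using B by (simp add: v_def field_simps)
    have int_v: "integrable M v"
      using v by (intro int_cont[of _ 1]) (auto simp: bump_functions_def)
    have "(LINT x|M. w x) = 2 * B * T v - B * c"
      unfolding w_v using int_v by (simp add: bump_eq[OF v] meas space)
    also have "\<dots> = T (\<lambda>x. 2 * B * v x - B)"
      using bump_continuous[OF v]
      by (subst pos_functional_diff[OF T])
         (auto simp: pos_functional_cmult[OF T] pos_functional_const[OF T] intro!: continuous_intros)
    also have "\<dots> = T u"
      using w(1,2) u by (intro pos_functional_cong[OF T]) (auto simp: w_v[symmetric])
    finally have Tw: "(LINT x|M. w x) = T u" .
    have int_w: "integrable M w" using w by (intro int_cont[of _ B]) auto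
    have ind_int: "integrable M (\<lambda>x. indicator K x *\<^sub>R w x)"
      using K_sets space int_w by (intro integrable_mult_indicator) auto
    \<comment> \<open>Off \<open>K\<close> nothing is known about \<open>u\<close>, not even
      measurability, so it is replaced by \<open>w\<close> under the indicator of
      \<open>K\<close>.\<close>
    have ind_eq: "(\<lambda>x. indicator K x * u x) = (\<lambda>x. indicator K x * w x)"
      using w(2) by (auto simp: indicator_def)
    have "(LINT x|M. indicator K x *\<^sub>R w x) = (LINT x|M. w x)"
      using AE_K ind_int int_w by (intro integral_cong_AE) auto
    then show ?thesis
      using K_sets ind_int Tw by (simp add: integrable_restrict_space integral_restrict_space ind_eq)
  qed
  show ?thesis
  proof
    show "sets (restrict_space M K) = sets (restrict_space borel K)"
      by (rule sets_restrict_space_cong[OF M(1)])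
    have "emeasure M K = emeasure M UNIV"
      using AE_K Kclosed M(1) by (intro emeasure_eq_AE) auto
    then show "emeasure (restrict_space M K) K = ennreal c"
      using K_sets by (simp add: emeasure_restrict_space mass)
  qed (rule repr)
qed

end

text \<open>The converse direction of Riesz representation; it embeds tuples of \<open>N\<close>
  into the compact set of functionals. The branch \<open>else 0\<close> matches the normalisation in
  \<open>pos_functionals\<close>.\<close>

lemma integral_pos_functional:
  fixes K :: "'a::euclidean_space set"
  assumes \<mu>: "sets \<mu> = sets (restrict_space borel K)" "emeasure \<mu> K = ennreal c" "0 \<le> c" "compact K"
  shows "(\<lambda>u. if continuous_on K u then LINT x|\<mu>. u x else 0) \<in> pos_functionals K c"
proof -
  have space: "space \<mu> = K"
    using sets_eq_imp_space_eq[OF \<mu>(1)] by (simp add: space_restrict_space)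
  interpret finite_measure \<mu>
    by (rule finite_measureI) (simp add: space \<mu>)
  have meas: "measure \<mu> K = c"
    using \<mu> by (simp add: measure_def)
  have int: "integrable \<mu> u" if u: "continuous_on K u" for u :: "'a \<Rightarrow> real"
  proof -
    have "bounded (u ` K)"
      using compact_continuous_image[OF u \<mu>(4)] compact_imp_bounded by blast
    then obtain B where "\<And>x. x \<in> K \<Longrightarrow> norm (u x) \<le> B"
      unfolding bounded_iff by auto
    moreover have "u \<in> borel_measurable \<mu>"
      using borel_measurable_continuous_on_restrict[OF u] measurable_cong_sets[OF \<mu>(1) refl] by blast
    ultimately show ?thesis
      by (intro integrable_const_bound[of _ B]) (auto simp: space)
  qed
  show ?thesis
    unfolding pos_functionals_def
    by (auto simp: int meas space continuous_on_add continuous_on_mult_left continuous_on_const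
        intro!: integral_nonneg_AE AE_I2)
qed

section \<open>A minimax theorem\<close>

lemma compact_PiE_UNIV:
  fixes B :: "'i \<Rightarrow> 'a::topological_space set"
  assumes "\<And>i. compact (B i)"
  shows "compact (PiE UNIV B)"
  using assms compactin_PiE[of "\<lambda>_. euclidean" UNIV B] by (simp add: euclidean_product_topology)

lemma continuous_on_fst_apply:
  "continuous_on UNIV (\<lambda>P :: ('u \<Rightarrow> 'a::topological_space) \<times> 'b::topological_space. fst P u)"
  by (rule continuous_on_product_then_coordinatewise[of UNIV fst u, OF continuous_on_fst[OF continuous_on_id]])

lemma continuous_on_snd_apply:
  "continuous_on UNIV (\<lambda>P :: 'b::topological_space \<times> ('i \<Rightarrow> 'u \<Rightarrow> 'a::topological_space). snd P i u)"
  by (rule continuous_on_product_then_coordinatewise[of UNIV "\<lambda>P. snd P i" u,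
        OF continuous_on_product_then_coordinatewise[of UNIV snd i, OF continuous_on_snd[OF continuous_on_id]]])

text \<open>Every condition compares finitely many evaluations of \<open>T\<close>, and the side
  conditions on \<open>u\<close> and \<open>v\<close> do not involve \<open>T\<close>; the set is an
  intersection of closed sets.\<close>

lemma closed_pos_functionals: "closed (pos_functionals K c)"
proof -
  have ev: "continuous_on UNIV (\<lambda>T :: ('a \<Rightarrow> real) \<Rightarrow> real. T u)" for u
    by (rule continuous_on_product_coordinates)
  have imp: "closed {T. P \<longrightarrow> Q T}" if "closed {T. Q T}" for P and Q :: "(('a \<Rightarrow> real) \<Rightarrow> real) \<Rightarrow> bool"
    using that by (cases P) simp_all
  show ?thesis
    unfolding pos_functionals_def
    by (intro closed_Collect_conj closed_Collect_all imp)
       (rule closed_Collect_eq closed_Collect_le; intro continuous_on_add continuous_on_mult_left ev continuous_on_const)+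
qed

text \<open>The Banach-Alaoglu argument: if \<open>\<bar>u x\<bar> \<le> b\<close> on
  \<open>K\<close>, then positivity and the mass give \<open>\<bar>T u\<bar> \<le> b * c\<close>, so
  the functionals form a closed subset of a product of compact intervals.\<close>

lemma compact_pos_functionals:
  assumes "compact K"
  shows "compact (pos_functionals K c)"
proof -
  have "\<exists>b. \<forall>T\<in>pos_functionals K c. \<bar>T u\<bar> \<le> b" for u
  proof (cases "continuous_on K u")
    case True
    then have "bounded (u ` K)"
      using compact_continuous_image assms compact_imp_bounded by blast
    then obtain b where b: "\<And>x. x \<in> K \<Longrightarrow> \<bar>u x\<bar> \<le> b"
      unfolding bounded_iff by auto
    have "\<bar>T u\<bar> \<le> b * c" if T: "T \<in> pos_functionals K c" for T
    proof -
      have "T u \<le> T (\<lambda>x. b)" "T (\<lambda>x. - b) \<le> T u"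
        using b by (intro pos_functional_mono[OF T] True continuous_on_const; fastforce simp: abs_le_iff)+
      then show ?thesis by (simp add: pos_functional_const[OF T])
    qed
    then show ?thesis by blast
  next
    case False
    then show ?thesis unfolding pos_functionals_def by (intro exI[of _ 0]) auto
  qed
  then obtain b where b: "\<And>u T. T \<in> pos_functionals K c \<Longrightarrow> \<bar>T u\<bar> \<le> b u" by metis
  have "pos_functionals K c \<subseteq> PiE UNIV (\<lambda>u. {- b u..b u})"
    using b by (auto simp: abs_le_iff minus_le_iff)
  moreover have "compact (PiE UNIV (\<lambda>u. {- b u..b u}))"
    by (intro compact_PiE_UNIV) auto
  ultimately show ?thesis
    using compact_Int_closed[OF _ closed_pos_functionals, of "PiE UNIV (\<lambda>u. {- b u..b u})" K c]
    by (simp only: inf.absorb2)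
qed

lemma pos_functionals_convex:
  assumes S: "S \<in> pos_functionals K c" and T: "T \<in> pos_functionals K c" and t: "0 \<le> t" "t \<le> 1"
  shows "(\<lambda>u. (1 - t) * S u + t * T u) \<in> pos_functionals K c"
  unfolding pos_functionals_def
proof (intro CollectI conjI allI impI)
  fix u :: "'a \<Rightarrow> real" assume "continuous_on K u" "\<forall>x\<in>K. 0 \<le> u x"
  then show "0 \<le> (1 - t) * S u + t * T u"
    using pos_functional_nonneg[OF S, of u] pos_functional_nonneg[OF T, of u] t by simp
next
  fix u v :: "'a \<Rightarrow> real" assume "continuous_on K u" "continuous_on K v"
  then have "S (\<lambda>x. u x + v x) = S u + S v" "T (\<lambda>x. u x + v x) = T u + T v"
    by (simp_all only: pos_functional_add[OF S] pos_functional_add[OF T])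
  then show "(1 - t) * S (\<lambda>x. u x + v x) + t * T (\<lambda>x. u x + v x) =
      (1 - t) * S u + t * T u + ((1 - t) * S v + t * T v)"
    by (simp add: algebra_simps)
next
  fix r and u :: "'a \<Rightarrow> real" assume "continuous_on K u"
  then have "S (\<lambda>x. r * u x) = r * S u" "T (\<lambda>x. r * u x) = r * T u"
    by (simp_all only: pos_functional_cmult[OF S] pos_functional_cmult[OF T])
  then show "(1 - t) * S (\<lambda>x. r * u x) + t * T (\<lambda>x. r * u x) = r * ((1 - t) * S u + t * T u)"
    by (simp add: algebra_simps)
next
  show "(1 - t) * S (\<lambda>x. 1) + t * T (\<lambda>x. 1) = c"
    unfolding pos_functional_one[OF S] pos_functional_one[OF T] by (simp add: algebra_simps)
next
  fix u :: "'a \<Rightarrow> real" assume "\<not> continuous_on K u"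
  then show "(1 - t) * S u + t * T u = 0"
    using S T by (simp add: pos_functionals_def)
qed

text \<open>The image of \<open>A\<close> under \<open>(p, q)\<close> is convex and avoids the open quadrant below \<open>(c, c)\<close>; a
  separating line has nonnegative coefficients, which are the weights.\<close>

lemma minimax_pair:
  fixes p q :: "'t \<Rightarrow> real"
  assumes conv: "\<And>S T t. S \<in> A \<Longrightarrow> T \<in> A \<Longrightarrow> 0 \<le> t \<Longrightarrow> t \<le> 1 \<Longrightarrow>
      \<exists>R\<in>A. p R = (1 - t) * p S + t * p T \<and> q R = (1 - t) * q S + t * q T"
    and max: "\<And>T. T \<in> A \<Longrightarrow> c \<le> p T \<or> c \<le> q T"
  shows "\<exists>t. 0 \<le> t \<and> t \<le> 1 \<and> (\<forall>T\<in>A. c \<le> (1 - t) * p T + t * q T)"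
proof (cases "A = {}")
  case True
  then show ?thesis by (intro exI[of _ 0]) auto
next
  case False
  define Q where "Q = {..<c} \<times> {..<c}"
  define E where "E = (\<lambda>T. (p T, q T)) ` A"
  have convQ: "convex Q"
    unfolding Q_def by (intro convex_Times) auto
  have convE: "convex E"
    unfolding convex_alt
  proof (intro ballI allI impI)
    fix x y t assume "x \<in> E" "y \<in> E" "0 \<le> (t::real) \<and> t \<le> 1"
    then obtain S T where "x = (p S, q S)" "y = (p T, q T)" "S \<in> A" "T \<in> A"
      unfolding E_def by auto
    moreover then obtain R where "R \<in> A" "p R = (1 - t) * p S + t * p T" "q R = (1 - t) * q S + t * q T"
      using conv[of S T t] \<open>0 \<le> t \<and> t \<le> 1\<close> by blast
    ultimately show "(1 - t) *\<^sub>R x + t *\<^sub>R y \<in> E"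
      unfolding E_def by (intro image_eqI[of _ _ R]) auto
  qed
  have "(c - 1, c - 1) \<in> Q" by (simp add: Q_def)
  then have "Q \<noteq> {}" by blast
  moreover have "E \<noteq> {}" using False by (simp add: E_def)
  moreover have "Q \<inter> E = {}"
  proof -
    have "(p T, q T) \<notin> Q" if "T \<in> A" for T
      using max[OF that] by (auto simp: Q_def)
    then show ?thesis by (auto simp: E_def)
  qed
  ultimately obtain a b where ab: "a \<noteq> 0" "\<forall>x\<in>Q. inner a x \<le> b" "\<forall>x\<in>E. b \<le> inner a x"
    using separating_hyperplane_sets[OF convQ convE] by metis
  obtain a1 a2 where a: "a = (a1, a2)" by (cases a)
  have Q: "a1 * r + a2 * s \<le> b" if "r < c" "s < c" for r s
    using ab(2) that by (auto simp: Q_def a)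
  have a1: "0 \<le> a1"
  proof (rule ccontr)
    assume "\<not> 0 \<le> a1"
    then have neg: "a1 < 0" by simp
    \<comment> \<open>With a negative coefficient, going far enough left inside the quadrant pushes
      the linear form above \<open>b\<close>. The quotient is where it reaches \<open>b + 1\<close>,
      and the minimum with \<open>c - 1\<close> keeps the point in \<open>Q\<close>.\<close>
    define r where "r = min (c - 1) ((b - a2 * (c - 1) + 1) / a1)"
    have "a1 * ((b - a2 * (c - 1) + 1) / a1) \<le> a1 * r"
      using neg by (intro mult_left_mono_neg) (auto simp: r_def)
    then have "b - a2 * (c - 1) + 1 \<le> a1 * r" using neg by simp
    moreover have "a1 * r + a2 * (c - 1) \<le> b" by (rule Q) (auto simp: r_def)
    ultimately show False by simp
  qed
  have a2: "0 \<le> a2"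
  proof (rule ccontr)
    assume "\<not> 0 \<le> a2"
    then have neg: "a2 < 0" by simp
    define r where "r = min (c - 1) ((b - a1 * (c - 1) + 1) / a2)"
    have "a2 * ((b - a1 * (c - 1) + 1) / a2) \<le> a2 * r"
      using neg by (intro mult_left_mono_neg) (auto simp: r_def)
    then have "b - a1 * (c - 1) + 1 \<le> a2 * r" using neg by simp
    moreover have "a1 * (c - 1) + a2 * r \<le> b" by (rule Q) (auto simp: r_def)
    ultimately show False by simp
  qed
  have pos: "0 < a1 + a2" using a1 a2 ab(1) a by (auto simp: zero_prod_def)
  \<comment> \<open>The corner \<open>(c, c)\<close> is a limit of points of \<open>Q\<close> along
    the diagonal, so it obeys the same bound.\<close>
  have cb: "(a1 + a2) * c \<le> b"
  proof (rule field_le_epsilon)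
    fix e :: real assume e: "0 < e"
    define d where "d = e / (a1 + a2)"
    have d: "0 < d" "(a1 + a2) * d = e" using pos e by (simp_all add: d_def)
    have "a1 * (c - d) + a2 * (c - d) \<le> b"
      using d(1) by (intro Q) auto
    then show "(a1 + a2) * c \<le> b + e"
      unfolding d(2)[symmetric] by (simp add: algebra_simps)
  qed
  have "c \<le> (1 - a2 / (a1 + a2)) * p T + a2 / (a1 + a2) * q T" if "T \<in> A" for T
  proof -
    have "b \<le> a1 * p T + a2 * q T"
      using ab(3) that by (auto simp: E_def a)
    then have "(a1 + a2) * c \<le> a1 * p T + a2 * q T" using cb by simp
    moreover have "1 - a2 / (a1 + a2) = a1 / (a1 + a2)"
      using pos by (simp add: field_simps)
    then have "(1 - a2 / (a1 + a2)) * p T + a2 / (a1 + a2) * q T = (a1 * p T + a2 * q T) / (a1 + a2)"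
      by (simp add: add_divide_distrib)
    ultimately show ?thesis using pos by (simp add: pos_le_divide_eq mult.commute)
  qed
  then show ?thesis
    using a1 a2 pos by (intro exI[of _ "a2 / (a1 + a2)"]) auto
qed

text \<open>Contrapositive of the finite intersection property. The set \<open>A\<close> must vary
  in the induction, since the induction hypothesis is applied to the part of \<open>A\<close> on
  which the new function is below \<open>c\<close>.\<close>

lemma finite_minimax:
  fixes V :: "('t \<Rightarrow> real) set"
  assumes W: "finite W" "W \<noteq> {}" "W \<subseteq> V"
    and "\<And>S T t. S \<in> A \<Longrightarrow> T \<in> A \<Longrightarrow> 0 \<le> t \<Longrightarrow> t \<le> 1 \<Longrightarrow>
      \<exists>R\<in>A. \<forall>v\<in>V. v R = (1 - t) * v S + t * v T"
    and "\<And>p q t. p \<in> V \<Longrightarrow> q \<in> V \<Longrightarrow> 0 \<le> t \<Longrightarrow> t \<le> 1 \<Longrightarrow>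
      \<exists>r\<in>V. \<forall>T\<in>A. r T = (1 - t) * p T + t * q T"
    and "\<And>T. T \<in> A \<Longrightarrow> \<exists>w\<in>W. c \<le> w T"
  shows "\<exists>v\<in>V. \<forall>T\<in>A. c \<le> v T"
  using assms
proof (induction W arbitrary: A rule: finite_ne_induct)
  case (singleton w)
  then show ?case by (intro bexI[of _ w]) simp_all
next
  case (insert w W)
  define A' where "A' = {T\<in>A. w T < c}"
  have wV: "w \<in> V" using insert.prems by auto
  \<comment> \<open>On \<open>A'\<close> the function \<open>w\<close> is no help, so some member of
    \<open>W\<close> must reach \<open>c\<close> there; \<open>A'\<close> inherits convexity because
    \<open>w\<close> is affine along the combinations.\<close>
  have "\<exists>v\<in>V. \<forall>T\<in>A'. c \<le> v T"
  proof (rule insert.IH)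
    show "W \<subseteq> V" using insert.prems by auto
  next
    fix S T and t :: real assume ST: "S \<in> A'" "T \<in> A'" "0 \<le> t" "t \<le> 1"
    then obtain R where R: "R \<in> A" "\<forall>v\<in>V. v R = (1 - t) * v S + t * v T"
      using insert.prems(2)[of S T t] unfolding A'_def by auto
    moreover have "(1 - t) * w S + t * w T < c"
      using ST by (intro convex_bound_lt) (auto simp: A'_def)
    ultimately have "R \<in> A'" using wV by (auto simp: A'_def)
    then show "\<exists>R\<in>A'. \<forall>v\<in>V. v R = (1 - t) * v S + t * v T" using R by blast
  next
    fix p q and t :: real assume "p \<in> V" "q \<in> V" "0 \<le> t" "t \<le> 1"
    then show "\<exists>r\<in>V. \<forall>T\<in>A'. r T = (1 - t) * p T + t * q T"
      using insert.prems(3)[of p q t] unfolding A'_def by auto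
  next
    fix T assume "T \<in> A'"
    then show "\<exists>w\<in>W. c \<le> w T"
      using insert.prems(4)[of T] unfolding A'_def by auto
  qed
  then obtain v where v: "v \<in> V" "\<And>T. T \<in> A' \<Longrightarrow> c \<le> v T" by blast
  \<comment> \<open>Everywhere on \<open>A\<close> now \<open>w\<close> or \<open>v\<close> reaches
    \<open>c\<close>, so two functions remain to be merged into one.\<close>
  have "\<exists>t. 0 \<le> t \<and> t \<le> 1 \<and> (\<forall>T\<in>A. c \<le> (1 - t) * w T + t * v T)"
  proof (rule minimax_pair)
    fix S T and t :: real assume "S \<in> A" "T \<in> A" "0 \<le> t" "t \<le> 1"
    then obtain R where "R \<in> A" "\<forall>v\<in>V. v R = (1 - t) * v S + t * v T"
      using insert.prems(2) by blast
    then show "\<exists>R\<in>A. w R = (1 - t) * w S + t * w T \<and> v R = (1 - t) * v S + t * v T"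
      using wV v(1) by blast
  next
    fix T assume "T \<in> A"
    then show "c \<le> w T \<or> c \<le> v T" using v(2)[of T] by (cases "w T < c") (auto simp: A'_def)
  qed
  then obtain t where t: "0 \<le> t" "t \<le> 1" "\<And>T. T \<in> A \<Longrightarrow> c \<le> (1 - t) * w T + t * v T" by blast
  obtain r where "r \<in> V" "\<forall>T\<in>A. r T = (1 - t) * w T + t * v T"
    using insert.prems(3)[OF wV v(1) t(1,2)] by blast
  then show ?case using t(3) by metis
qed

text \<open>The conclusion is a weak inequality because the sublevel sets must be closed; the strict
  one in \<open>below\<close> is what contradicts a single \<open>v\<close> with
  \<open>c \<le> v\<close> on all of \<open>A\<close>.\<close>

lemma compact_minimax:
  fixes V :: "('t::topological_space \<Rightarrow> real) set"
  assumes A: "compact A" and "V \<noteq> {}"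
    and cont: "\<And>v. v \<in> V \<Longrightarrow> continuous_on UNIV v"
    and convA: "\<And>S T t. S \<in> A \<Longrightarrow> T \<in> A \<Longrightarrow> 0 \<le> t \<Longrightarrow> t \<le> 1 \<Longrightarrow>
      \<exists>R\<in>A. \<forall>v\<in>V. v R = (1 - t) * v S + t * v T"
    and convV: "\<And>p q t. p \<in> V \<Longrightarrow> q \<in> V \<Longrightarrow> 0 \<le> t \<Longrightarrow> t \<le> 1 \<Longrightarrow>
      \<exists>r\<in>V. \<forall>T\<in>A. r T = (1 - t) * p T + t * q T"
    and below: "\<And>v. v \<in> V \<Longrightarrow> \<exists>T\<in>A. v T < c"
  shows "\<exists>T\<in>A. \<forall>v\<in>V. v T \<le> c"
proof -
  have "A \<inter> (\<Inter>v\<in>V. {T. v T \<le> c}) \<noteq> {}"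
  proof (rule compact_imp_fip_image[OF A])
    fix v assume "v \<in> V"
    then show "closed {T. v T \<le> c}"
      by (intro closed_Collect_le cont continuous_on_const)
  next
    fix W assume W: "finite W" "W \<subseteq> V"
    show "A \<inter> (\<Inter>v\<in>W. {T. v T \<le> c}) \<noteq> {}"
    proof
      assume empty: "A \<inter> (\<Inter>v\<in>W. {T. v T \<le> c}) = {}"
      have "A \<noteq> {}" using below \<open>V \<noteq> {}\<close> by blast
      then have "W \<noteq> {}" using empty by auto
      have "\<exists>w\<in>W. c \<le> w T" if "T \<in> A" for T
        using empty that by (force simp: not_le intro: less_imp_le)
      then obtain v where "v \<in> V" "\<forall>T\<in>A. c \<le> v T"
        using finite_minimax[OF W(1) \<open>W \<noteq> {}\<close> W(2) convA convV] by blast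
      then show False using below by (meson not_le)
    qed
  qed
  then show ?thesis by auto
qed

section \<open>Multipliers and masses\<close>

lemma C1_maps_differentiable: "\<theta> \<in> C1_maps \<Longrightarrow> \<theta> differentiable (at p)"
  unfolding C1_maps_def by blast

lemma C1_maps_continuous: "\<theta> \<in> C1_maps \<Longrightarrow> continuous_on A \<theta>"
  by (meson C1_maps_differentiable continuous_at_imp_continuous_on differentiable_imp_continuous_within)

lemma C1_maps_continuous_derivative:
  "\<theta> \<in> C1_maps \<Longrightarrow> continuous_on A (\<lambda>p. frechet_derivative \<theta> (at p) v)"
  unfolding C1_maps_def using continuous_on_subset subset_UNIV by blast

text \<open>Expanding the trace leaves derivatives in fixed directions, the form in which
  \<open>C1_maps\<close> provides continuity.\<close>

lemma total_div_eq:
  "total_div \<theta> q =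
     (\<Sum>i\<in>UNIV. frechet_derivative \<theta> (at (fst q, fst (snd q))) (axis i 1, 0) $ i) +
     (\<Sum>i\<in>UNIV. \<Sum>j\<in>UNIV. snd (snd q) $ i $ j *
        frechet_derivative \<theta> (at (fst q, fst (snd q))) (0, axis i 1) $ j)"
  by (cases q) (simp add: total_div_def div_x_def jac_y_def trace_def matrix_matrix_mult_def)

lemma continuous_total_div:
  assumes "\<theta> \<in> C1_maps"
  shows "continuous_on A (total_div \<theta>)"
proof -
  have "continuous_on A (\<lambda>q. frechet_derivative \<theta> (at (fst q, fst (snd q))) v)" for v
    by (rule continuous_on_compose2[OF C1_maps_continuous_derivative[OF assms, of UNIV v]])
       (auto intro!: continuous_intros)
  then show ?thesis
    unfolding total_div_eq[abs_def] by (intro continuous_intros)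
qed

lemma continuous_flux:
  assumes "\<theta> \<in> C1_maps" "continuous_on (S i) (n i)"
  shows "continuous_on (Gam S Y i) (flux n \<theta> i)"
proof -
  have "continuous_on (Gam S Y i) (\<lambda>p. n i (fst p))"
    by (rule continuous_on_compose2[OF assms(2)]) (auto simp: Gam_def intro!: continuous_intros)
  then show ?thesis
    unfolding flux_def case_prod_beta
    using C1_maps_continuous[OF assms(1)] by (intro continuous_intros) auto
qed

lemma frechet_derivative_combination:
  assumes "\<theta> \<in> C1_maps" "\<eta> \<in> C1_maps"
  shows "frechet_derivative (\<lambda>p. r *\<^sub>R \<theta> p + s *\<^sub>R \<eta> p) (at p) =
    (\<lambda>v. r *\<^sub>R frechet_derivative \<theta> (at p) v + s *\<^sub>R frechet_derivative \<eta> (at p) v)"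
    and "(\<lambda>p. r *\<^sub>R \<theta> p + s *\<^sub>R \<eta> p) differentiable (at p)"
proof -
  have "((\<lambda>p. r *\<^sub>R \<theta> p + s *\<^sub>R \<eta> p) has_derivative
      (\<lambda>v. r *\<^sub>R frechet_derivative \<theta> (at p) v + s *\<^sub>R frechet_derivative \<eta> (at p) v)) (at p)"
    using assms[THEN C1_maps_differentiable, THEN frechet_derivative_works[THEN iffD1]]
    by (intro derivative_intros)
  then show "frechet_derivative (\<lambda>p. r *\<^sub>R \<theta> p + s *\<^sub>R \<eta> p) (at p) =
    (\<lambda>v. r *\<^sub>R frechet_derivative \<theta> (at p) v + s *\<^sub>R frechet_derivative \<eta> (at p) v)"
    and "(\<lambda>p. r *\<^sub>R \<theta> p + s *\<^sub>R \<eta> p) differentiable (at p)"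
    by (auto simp: frechet_derivative_at[symmetric] differentiable_def)
qed

lemma C1_maps_combination:
  "\<theta> \<in> C1_maps \<Longrightarrow> \<eta> \<in> C1_maps \<Longrightarrow> (\<lambda>p. r *\<^sub>R \<theta> p + s *\<^sub>R \<eta> p) \<in> C1_maps"
  using frechet_derivative_combination[of \<theta> \<eta> r s] C1_maps_continuous_derivative[of \<theta> UNIV]
    C1_maps_continuous_derivative[of \<eta> UNIV]
  by (auto simp: C1_maps_def intro!: continuous_intros)

lemma total_div_combination:
  assumes "\<theta> \<in> C1_maps" "\<eta> \<in> C1_maps"
  shows "total_div (\<lambda>p. r *\<^sub>R \<theta> p + s *\<^sub>R \<eta> p) q = r * total_div \<theta> q + s * total_div \<eta> q"
  unfolding total_div_eq frechet_derivative_combination(1)[OF assms]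
  by (simp add: sum.distrib distrib_left sum_distrib_left mult_ac)

lemma zero_C1_maps: "(\<lambda>p. 0) \<in> C1_maps"
  by (simp add: C1_maps_def frechet_derivative_const)

lemma total_div_zero: "total_div (\<lambda>p. 0) q = 0"
  by (simp add: total_div_eq frechet_derivative_const)

text \<open>Arbitrary coefficients let one operation serve both for convex combinations and, with
  \<open>s = 0\<close>, for the ray through a multiplier.\<close>

fun combine_multipliers ::
    "real \<Rightarrow> ('n::finite, 'm::finite, 's) multiplier \<Rightarrow> real \<Rightarrow> ('n, 'm, 's) multiplier \<Rightarrow> ('n, 'm, 's) multiplier" where
  "combine_multipliers r (a, \<phi>, \<psi>, \<theta>) s (b, \<phi>', \<psi>', \<eta>) =
     (r * a + s * b, \<lambda>q. r * \<phi> q + s * \<phi>' q, \<lambda>i p. r * \<psi> i p + s * \<psi>' i p, \<lambda>p. r *\<^sub>R \<theta> p + s *\<^sub>R \<eta> p)"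

lemma combine_multipliers_closed:
  "\<Lambda> \<in> multipliers X S Y Z \<Longrightarrow> \<Lambda>' \<in> multipliers X S Y Z \<Longrightarrow>
   combine_multipliers r \<Lambda> s \<Lambda>' \<in> multipliers X S Y Z"
  by (auto simp: multipliers_def C1_maps_combination intro!: continuous_intros)

text \<open>\<open>l\<close> enters \<open>F\<close> with fixed coefficient 1, so \<open>F\<close>
  is affine and not linear in the multiplier; the correction vanishes exactly for weights with sum 1
  or where \<open>l\<close> is 0.\<close>

lemma F_fun_combine:
  assumes "\<Lambda> \<in> multipliers X S Y Z" "\<Lambda>' \<in> multipliers X S Y Z"
  shows "F_fun l f g (combine_multipliers r \<Lambda> s \<Lambda>') q =
    (1 - r - s) * l q + r * F_fun l f g \<Lambda> q + s * F_fun l f g \<Lambda>' q"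
  using assms by (auto simp: multipliers_def F_fun_def total_div_combination algebra_simps)

lemma G_fun_combine:
  "G_fun n h (combine_multipliers r \<Lambda> s \<Lambda>') i p = r * G_fun n h \<Lambda> i p + s * G_fun n h \<Lambda>' i p"
  by (cases \<Lambda>; cases \<Lambda>'; cases p) (simp add: G_fun_def flux_def inner_left_distrib algebra_simps)

text \<open>The degenerate alternative \<open>c = 0\<close> covers empty boundary pieces.\<close>

lemma point_mass_exists:
  fixes K :: "'a::topological_space set"
  assumes "0 \<le> c" "c = 0 \<or> q \<in> K"
  obtains M where "sets M = sets (restrict_space borel K)" "emeasure M K = ennreal c"
    "\<And>u :: 'a \<Rightarrow> real. continuous_on K u \<Longrightarrow> integrable M u \<and> (LINT x|M. u x) = c * u q"
proof (cases "c = 0")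
  case True
  let ?M = "null_measure (restrict_space borel K)"
  show ?thesis
  proof
    fix u :: "'a \<Rightarrow> real" assume u: "continuous_on K u"
    have "u \<in> borel_measurable ?M"
      using borel_measurable_continuous_on_restrict[OF u] by simp
    then show "integrable ?M u \<and> (LINT x|?M. u x) = c * u q"
      using True by (simp add: integrable_iff_bounded nn_integral_null_measure)
  qed (use True in auto)
next
  case False
  then have q: "q \<in> K" using assms by simp
  \<comment> \<open>Pushing a one-point measure forward along a constant map gives a Dirac mass of
    weight \<open>c\<close> without asking whether singletons are measurable.\<close>
  define P where "P = point_measure {()} (\<lambda>_. ennreal c)"
  have meas: "(\<lambda>_. q) \<in> P \<rightarrow>\<^sub>M restrict_space borel K"
    using q by (intro measurable_const) (simp add: space_restrict_space)
  let ?M = "distr P (restrict_space borel K) (\<lambda>_. q)"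
  show ?thesis
  proof
    have "K \<in> sets (restrict_space borel K)"
      using sets.top[of "restrict_space borel K"] by (simp add: space_restrict_space)
    then show "emeasure ?M K = ennreal c"
      using q unfolding emeasure_distr[OF meas \<open>K \<in> sets (restrict_space borel K)\<close>]
      by (simp add: P_def space_point_measure emeasure_point_measure_finite)
  next
    fix u :: "'a \<Rightarrow> real" assume u: "continuous_on K u"
    have u_meas: "u \<in> borel_measurable (restrict_space borel K)"
      by (rule borel_measurable_continuous_on_restrict[OF u])
    show "integrable ?M u \<and> (LINT x|?M. u x) = c * u q"
      using assms(1) unfolding integrable_distr_eq[OF meas u_meas] integral_distr[OF meas u_meas]
      by (simp add: P_def measure_def space_point_measure emeasure_point_measure_finite
          integrable_point_measure_finite)
  qed simp
qed

text \<open>The case \<open>c = 0\<close> rests on the convention that 0 times an infinite value is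
  0; \<open>K\<close> may then be empty, with infimum \<open>\<infinity>\<close>.\<close>

lemma mass_INF_le_integral:
  fixes F :: "'a::topological_space \<Rightarrow> real"
  assumes M: "sets M = sets (restrict_space borel K)" "emeasure M K = ennreal c" and c: "0 \<le> c"
    and F: "integrable M F"
  shows "ereal c * (INF q\<in>K. ereal (F q)) \<le> ereal (LINT q|M. F q)"
proof -
  have space: "space M = K"
    using sets_eq_imp_space_eq[OF M(1)] by (simp add: space_restrict_space)
  interpret finite_measure M
    by (rule finite_measureI) (simp add: space M)
  have meas: "measure M (space M) = c"
    using M c by (simp add: measure_def space)
  show ?thesis
  proof (cases "c = 0")
    case True
    then have "emeasure M (space M) = 0" using M space by simp
    then have "AE x in M. F x = 0"
      by (intro AE_I'[of "space M"]) (auto simp: null_sets_def)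
    then have "(LINT q|M. F q) = (LINT q|M. 0)"
      using F by (intro integral_cong_AE) auto
    then show ?thesis using True by (simp add: zero_ereal_def[symmetric])
  next
    case False
    then have pos: "0 < c" using c by simp
    \<comment> \<open>Positive mass forces a point in \<open>K\<close>, which excludes the infimum
      \<open>\<infinity>\<close>.\<close>
    have "K \<noteq> {}" using False M pos by auto
    then obtain q where "q \<in> K" by blast
    then have "(INF q\<in>K. ereal (F q)) \<le> ereal (F q)" by (rule INF_lower)
    then have "(INF q\<in>K. ereal (F q)) \<noteq> \<infinity>" by auto
    then consider b where "(INF q\<in>K. ereal (F q)) = ereal b" | "(INF q\<in>K. ereal (F q)) = - \<infinity>"
      by (cases "INF q\<in>K. ereal (F q)") auto
    then show ?thesis
    proof cases
      case (1 b)
      then have "b \<le> F q" if "q \<in> K" for q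
        using INF_lower[OF that, of "\<lambda>q. ereal (F q)"] by simp
      then have "(LINT q|M. b) \<le> (LINT q|M. F q)"
        using F space by (intro integral_mono) auto
      then show ?thesis using 1 by (simp add: meas mult.commute)
    next
      case 2
      then show ?thesis using pos by simp
    qed
  qed
qed

text \<open>Keeps the dual objective free of sums of \<open>\<infinity>\<close> and
  \<open>-\<infinity>\<close>: its terms can be \<open>-\<infinity>\<close> but never
  \<open>\<infinity>\<close>.\<close>

lemma mass_INF_less_top:
  fixes F :: "'a \<Rightarrow> real"
  assumes "0 \<le> c" "c = 0 \<or> K \<noteq> {}"
  shows "ereal c * (INF x\<in>K. ereal (F x)) < \<infinity>"
proof (cases "c = 0")
  case False
  then obtain x where "x \<in> K" using assms(2) by blast
  then have "ereal c * (INF x\<in>K. ereal (F x)) \<le> ereal c * ereal (F x)"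
    using assms(1) by (intro ereal_mult_left_mono INF_lower) auto
  then show ?thesis by (rule order_le_less_trans) simp
qed (simp add: zero_ereal_def[symmetric])

lemma INF_mass_less_obtain:
  assumes "ereal c * (INF q\<in>K. ereal (F q)) < ereal r" "0 \<le> c" "c = 0 \<or> K \<noteq> {}"
  obtains q where "c = 0 \<or> q \<in> K" "c * F q \<le> r"
proof (cases "c = 0")
  case True
  then show ?thesis using assms that by (auto simp: zero_ereal_def[symmetric])
next
  case False
  then have c: "0 < c" using assms by simp
  have "(INF q\<in>K. ereal (F q)) < ereal (r / c)"
  proof (rule ccontr)
    assume "\<not> ?thesis"
    then have "ereal c * ereal (r / c) \<le> ereal c * (INF q\<in>K. ereal (F q))"
      using c by (intro ereal_mult_left_mono) auto
    then show False using assms(1) c by simp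
  qed
  then obtain q where "q \<in> K" "F q < r / c"
    unfolding INF_less_iff by auto
  then show ?thesis using that c by (simp add: field_simps)
qed

lemma ereal_add_less_obtain:
  fixes x y :: ereal
  assumes "x < \<infinity>" "y < \<infinity>" "x + y < ereal b"
  obtains r s where "x < ereal r" "y < ereal s" "r + s = b"
proof -
  have "\<exists>r s. x < ereal r \<and> y < ereal s \<and> r + s = b"
  proof (cases x)
    case (real x')
    show ?thesis
    proof (cases y)
      case (real y')
      then show ?thesis using assms \<open>x = ereal x'\<close>
        by (intro exI[of _ "x' + (b - x' - y') / 2"] exI[of _ "y' + (b - x' - y') / 2"]) (auto simp: field_simps)
    next
      case MInf
      then show ?thesis using \<open>x = ereal x'\<close>
        by (intro exI[of _ "x' + 1"] exI[of _ "b - (x' + 1)"]) auto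
    qed (use assms in auto)
  next
    case MInf
    obtain s where "y < ereal s" using assms(2) less_PInf_Ex_of_nat by (metis ereal_dense2)
    then show ?thesis using MInf by (intro exI[of _ "b - s"] exI[of _ s]) auto
  qed (use assms in auto)
  then show ?thesis using that by blast
qed

text \<open>Distributes a real budget \<open>b\<close> over the terms, so that the infima in the
  dual objective can be approached one at a time, even if some are
  \<open>-\<infinity>\<close>.\<close>

lemma ereal_sum_less_obtain:
  fixes t :: "'i \<Rightarrow> ereal"
  assumes "finite I" "\<And>i. i \<in> I \<Longrightarrow> t i < \<infinity>" "(\<Sum>i\<in>I. t i) < ereal b"
  shows "\<exists>r. (\<forall>i\<in>I. t i < ereal (r i)) \<and> (\<Sum>i\<in>I. r i) \<le> b"
  using assms
proof (induction I arbitrary: b)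
  case empty
  then show ?case by auto
next
  case (insert j I)
  have "(\<Sum>i\<in>I. t i) < \<infinity>"
    using insert.prems insert.hyps by (auto simp: less_top[symmetric] sum_Pinfty)
  then obtain r s where rs: "t j < ereal r" "(\<Sum>i\<in>I. t i) < ereal s" "r + s = b"
    using ereal_add_less_obtain[of "t j" "\<Sum>i\<in>I. t i" b] insert by auto
  then obtain r' where r': "\<forall>i\<in>I. t i < ereal (r' i)" "(\<Sum>i\<in>I. r' i) \<le> s"
    using insert.IH[of s] insert.prems by auto
  have "(\<Sum>i\<in>I. (r'(j := r)) i) = (\<Sum>i\<in>I. r' i)"
    using insert.hyps by (intro sum.cong) auto
  then show ?case
    using rs r' insert.hyps by (intro exI[of _ "r'(j := r)"]) auto
qed

lemma sum_UNIV_option: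
  fixes t :: "'i::finite option \<Rightarrow> 'b::comm_monoid_add"
  shows "(\<Sum>j\<in>UNIV. t j) = t None + (\<Sum>i\<in>UNIV. t (Some i))"
  by (simp add: UNIV_option_conv sum.reindex)

section \<open>Duality\<close>

locale relaxed_program =
  fixes X :: "(real ^ 'n::finite) set"
    and S :: "'s::finite \<Rightarrow> (real ^ 'n) set"
    and n :: "'s \<Rightarrow> real ^ 'n \<Rightarrow> real ^ 'n"
    and Y :: "(real ^ 'm::finite) set"
    and Z :: "(real ^ 'n ^ 'm) set"
    and l f g :: "('n, 'm) jet \<Rightarrow> real"
    and h :: "'s \<Rightarrow> ('n, 'm) pt \<Rightarrow> real"
  assumes X: "bounded X" "X \<noteq> {}"
    and S: "\<And>i. compact (S i)"
    and n: "\<And>i. continuous_on (S i) (n i)"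
    and YZ: "Y \<noteq> {}" "Z \<noteq> {}"
    and l: "continuous_on (Omega X Y Z) l"
    and f: "continuous_on (Omega X Y Z) f"
    and g: "continuous_on (Omega X Y Z) g"
    and h: "\<And>i. continuous_on (Gam S Y i) (h i)"
begin

abbreviation "N \<equiv> measures_N X S n Y Z l f g h"
abbreviation "feasible \<equiv> feasible_measures X S n Y Z l f g h"
abbreviation "M \<equiv> multipliers X S Y Z :: ('n, 'm, 's) multiplier set"
abbreviation "\<Omega> \<equiv> Omega X Y Z"
abbreviation "\<Gamma> \<equiv> Gam S Y :: 's \<Rightarrow> ('n, 'm) pt set"
abbreviation "L \<equiv> lagrangian n l f g h"
abbreviation "F \<equiv> F_fun l f g :: ('n, 'm, 's) multiplier \<Rightarrow> _"
abbreviation "G \<equiv> G_fun n h"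
abbreviation "energy_of m \<equiv> (LINT q|fst m. l q)"

lemma volume_nonneg: "0 \<le> volume X"
  by (simp add: volume_def)

lemma area_nonneg: "0 \<le> area (S i)"
  by (simp add: area_def)

lemma M_intro:
  "continuous_on \<Omega> \<phi> \<Longrightarrow> (\<And>i. continuous_on (\<Gamma> i) (\<psi> i)) \<Longrightarrow> \<theta> \<in> C1_maps \<Longrightarrow> (a, \<phi>, \<psi>, \<theta>) \<in> M"
  by (simp add: multipliers_def)

lemma zero_M: "(0, \<lambda>q. 0, \<lambda>i p. 0, \<lambda>p. 0) \<in> M"
  by (intro M_intro zero_C1_maps continuous_on_const)

lemma continuous_F: "\<Lambda> \<in> M \<Longrightarrow> continuous_on \<Omega> (F \<Lambda>)"
  unfolding multipliers_def F_fun_def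
  by (auto intro!: continuous_intros l f g continuous_total_div)

lemma continuous_G: "\<Lambda> \<in> M \<Longrightarrow> continuous_on (\<Gamma> i) (G \<Lambda> i)"
  unfolding multipliers_def G_fun_def
  by (auto intro!: continuous_intros h continuous_flux n)

lemma N_masses:
  assumes "(\<mu>, \<nu>) \<in> N"
  shows "sets \<mu> = sets (restrict_space borel \<Omega>)" "emeasure \<mu> \<Omega> = ennreal (volume X)"
    "sets (\<nu> i) = sets (restrict_space borel (\<Gamma> i))" "emeasure (\<nu> i) (\<Gamma> i) = ennreal (area (S i))"
  using assms by (simp_all add: measures_N_def)

lemma N_integrable:
  assumes "(\<mu>, \<nu>) \<in> N" "(a, \<phi>, \<psi>, \<theta>) \<in> M"
  shows "integrable \<mu> l" "integrable \<mu> f" "integrable \<mu> (\<lambda>q. \<phi> q * g q)" "integrable \<mu> (total_div \<theta>)"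
    "integrable (\<nu> i) (\<lambda>p. \<psi> i p * h i p)" "integrable (\<nu> i) (flux n \<theta> i)"
  using assms unfolding measures_N_def by fast+

lemma N_integrable_FG:
  assumes "(\<mu>, \<nu>) \<in> N" "\<Lambda> \<in> M"
  shows "integrable \<mu> (F \<Lambda>)" "integrable (\<nu> i) (G \<Lambda> i)"
proof -
  obtain a \<phi> \<psi> \<theta> where \<Lambda>: "\<Lambda> = (a, \<phi>, \<psi>, \<theta>)" by (metis prod_cases4)
  show "integrable \<mu> (F \<Lambda>)" "integrable (\<nu> i) (G \<Lambda> i)"
    using N_integrable[OF assms(1) assms(2)[unfolded \<Lambda>]] by (simp_all add: \<Lambda> F_fun_def G_fun_def)
qed

lemma N_intro:
  assumes "sets \<mu> = sets (restrict_space borel \<Omega>)" "emeasure \<mu> \<Omega> = ennreal (volume X)"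
    and "\<And>i. sets (\<nu> i) = sets (restrict_space borel (\<Gamma> i))"
    and "\<And>i. emeasure (\<nu> i) (\<Gamma> i) = ennreal (area (S i))"
    and \<mu>: "\<And>u :: _ \<Rightarrow> real. continuous_on \<Omega> u \<Longrightarrow> integrable \<mu> u"
    and \<nu>: "\<And>i u :: _ \<Rightarrow> real. continuous_on (\<Gamma> i) u \<Longrightarrow> integrable (\<nu> i) u"
  shows "(\<mu>, \<nu>) \<in> N"
proof -
  have "integrable \<mu> (\<lambda>q. \<phi> q * g q) \<and> integrable \<mu> (total_div \<theta>) \<and>
      (\<forall>i. integrable (\<nu> i) (\<lambda>p. \<psi> i p * h i p)) \<and> (\<forall>i. integrable (\<nu> i) (flux n \<theta> i))"
    if "(a, \<phi>, \<psi>, \<theta>) \<in> M" for a \<phi> \<psi> \<theta>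
    using that unfolding multipliers_def
    by (auto intro!: \<mu> \<nu> continuous_on_mult g h continuous_total_div continuous_flux n)
  then show ?thesis
    using assms l f unfolding measures_N_def by auto
qed

lemma lagrangian_eq:
  assumes "(\<mu>, \<nu>) \<in> N" "(a, \<phi>, \<psi>, \<theta>) \<in> M"
  shows "L (\<mu>, \<nu>) (a, \<phi>, \<psi>, \<theta>) =
    (LINT q|\<mu>. l q) + a * (LINT q|\<mu>. f q) + (LINT q|\<mu>. \<phi> q * g q) +
    (\<Sum>i\<in>UNIV. LINT p|\<nu> i. \<psi> i p * h i p) +
    ((LINT q|\<mu>. total_div \<theta> q) - (\<Sum>i\<in>UNIV. LINT p|\<nu> i. flux n \<theta> i p))"
  using N_integrable[OF assms] by (simp add: lagrangian_def F_fun_def G_fun_def sum_subtractf)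

lemma lagrangian_combine:
  assumes "m \<in> N" "\<Lambda> \<in> M" "\<Lambda>' \<in> M"
  shows "L m (combine_multipliers r \<Lambda> s \<Lambda>') = (1 - r - s) * energy_of m + r * L m \<Lambda> + s * L m \<Lambda>'"
proof -
  obtain \<mu> \<nu> where m: "m = (\<mu>, \<nu>)" by (cases m)
  note mN = assms(1)[unfolded m]
  have F_eq: "F (combine_multipliers r \<Lambda> s \<Lambda>') = (\<lambda>q. (1 - r - s) * l q + r * F \<Lambda> q + s * F \<Lambda>' q)"
    and G_eq: "G (combine_multipliers r \<Lambda> s \<Lambda>') i = (\<lambda>p. r * G \<Lambda> i p + s * G \<Lambda>' i p)" for i
    by (rule ext, rule F_fun_combine[OF assms(2,3)]) (rule ext, rule G_fun_combine)
  show ?thesis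
    using N_integrable(1)[OF mN zero_M] N_integrable_FG[OF mN assms(2)] N_integrable_FG[OF mN assms(3)]
    by (simp add: lagrangian_def m F_eq G_eq sum.distrib
        sum_distrib_left[symmetric] distrib_left)
qed

text \<open>By \<open>lagrangian_eq\<close>, the components of a multiplier are paired with separate
  constraints; letting all but one of them vanish isolates one constraint.\<close>

lemma feasible_iff:
  assumes "m \<in> N"
  shows "m \<in> feasible \<longleftrightarrow> (\<forall>\<Lambda>\<in>M. L m \<Lambda> = energy_of m)"
proof -
  obtain \<mu> \<nu> where m: "m = (\<mu>, \<nu>)" by (cases m)
  note mN = assms[unfolded m]
  show ?thesis
  proof
    assume feas: "m \<in> feasible"
    show "\<forall>\<Lambda>\<in>M. L m \<Lambda> = energy_of m"
    proof
      fix \<Lambda> assume \<Lambda>: "\<Lambda> \<in> M"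
      obtain a \<phi> \<psi> \<theta> where eq: "\<Lambda> = (a, \<phi>, \<psi>, \<theta>)" by (metis prod_cases4)
      have cont: "continuous_on \<Omega> \<phi>" "\<And>i. continuous_on (\<Gamma> i) (\<psi> i)" "\<theta> \<in> C1_maps"
        using \<Lambda> eq by (auto simp: multipliers_def)
      have "(LINT q|\<mu>. f q) = 0" "(LINT q|\<mu>. \<phi> q * g q) = 0" "\<And>i. (LINT p|\<nu> i. \<psi> i p * h i p) = 0"
        "(LINT q|\<mu>. total_div \<theta> q) - (\<Sum>i\<in>UNIV. LINT p|\<nu> i. flux n \<theta> i p) = 0"
        using feas cont unfolding feasible_measures_def m by auto
      then show "L m \<Lambda> = energy_of m"
        using lagrangian_eq[OF mN \<Lambda>[unfolded eq]] by (simp add: m eq)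
    qed
  next
    assume const: "\<forall>\<Lambda>\<in>M. L m \<Lambda> = energy_of m"
    have eq: "a * (LINT q|\<mu>. f q) + (LINT q|\<mu>. \<phi> q * g q) + (\<Sum>i\<in>UNIV. LINT p|\<nu> i. \<psi> i p * h i p) +
        ((LINT q|\<mu>. total_div \<theta> q) - (\<Sum>i\<in>UNIV. LINT p|\<nu> i. flux n \<theta> i p)) = 0"
      if "(a, \<phi>, \<psi>, \<theta>) \<in> M" for a \<phi> \<psi> \<theta>
      using lagrangian_eq[OF mN that] const that m by simp
    have fl0: "flux n (\<lambda>p. 0) i p = 0" for i and p :: "('n, 'm) pt"
      by (simp add: flux_def case_prod_beta)
    have "(LINT q|\<mu>. f q) = 0"
      using eq[of 1 "\<lambda>q. 0" "\<lambda>i p. 0" "\<lambda>p. 0"]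
      by (simp add: M_intro zero_C1_maps total_div_zero fl0)
    moreover have "(LINT q|\<mu>. \<phi> q * g q) = 0" if "continuous_on \<Omega> \<phi>" for \<phi>
      using eq[of 0 \<phi> "\<lambda>i p. 0" "\<lambda>p. 0"] that
      by (simp add: M_intro zero_C1_maps total_div_zero fl0)
    moreover have "(LINT p|\<nu> i. \<psi> p * h i p) = 0" if "continuous_on (\<Gamma> i) \<psi>" for i \<psi>
    proof -
      \<comment> \<open>Concentrated on the index \<open>i\<close>, so that the sum over the
        boundary pieces reduces to one term.\<close>
      define \<psi>' where "\<psi>' j p = (if j = i then \<psi> p else 0)" for j p
      have "continuous_on (\<Gamma> j) (\<psi>' j)" for j
        using that by (cases "j = i") (simp_all add: \<psi>'_def)
      then have "(\<Sum>j\<in>UNIV. LINT p|\<nu> j. \<psi>' j p * h j p) = 0"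
        using eq[of 0 "\<lambda>q. 0" \<psi>' "\<lambda>p. 0"]
        by (simp add: M_intro zero_C1_maps total_div_zero fl0)
      moreover have "(\<Sum>j\<in>UNIV. LINT p|\<nu> j. \<psi>' j p * h j p) =
          (\<Sum>j\<in>UNIV. if j = i then LINT p|\<nu> i. \<psi> p * h i p else 0)"
        by (intro sum.cong) (auto simp: \<psi>'_def)
      ultimately show ?thesis by simp
    qed
    moreover have "(LINT q|\<mu>. total_div \<theta> q) - (\<Sum>i\<in>UNIV. LINT p|\<nu> i. flux n \<theta> i p) = 0"
      if "\<theta> \<in> C1_maps" for \<theta>
      using eq[of 0 "\<lambda>q. 0" "\<lambda>i p. 0" \<theta>] that by (simp add: M_intro)
    ultimately show "m \<in> feasible"
      using mN unfolding feasible_measures_def m mem_Collect_eq case_prod_conv by blast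
  qed
qed

lemma SUP_lagrangian:
  assumes m: "m \<in> N"
  shows "(SUP \<Lambda>\<in>M. ereal (L m \<Lambda>)) = (if m \<in> feasible then ereal (energy_of m) else \<infinity>)"
proof (cases "m \<in> feasible")
  case True
  then have "(SUP \<Lambda>\<in>M. ereal (L m \<Lambda>)) = (SUP \<Lambda>\<in>M. ereal (energy_of m))"
    using feasible_iff[OF m] by (intro SUP_cong) auto
  also have "\<dots> = ereal (energy_of m)"
    using zero_M by (intro SUP_const) auto
  finally show ?thesis using True by simp
next
  case False
  then obtain \<Lambda> where \<Lambda>: "\<Lambda> \<in> M" "L m \<Lambda> \<noteq> energy_of m"
    using feasible_iff[OF m] by blast
  define d where "d = L m \<Lambda> - energy_of m"
  have "ereal b \<le> (SUP \<Lambda>\<in>M. ereal (L m \<Lambda>))" for b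
  proof -
    \<comment> \<open>Along the ray through \<open>\<Lambda>\<close> the Lagrangian is
      \<open>energy_of m + t * d\<close> with \<open>d \<noteq> 0\<close>; as \<open>t\<close> may
      have either sign, every real value \<open>b\<close> is attained.\<close>
    let ?t = "(b - energy_of m) / d"
    have "L m (combine_multipliers t \<Lambda> 0 \<Lambda>) = energy_of m + t * d" for t
      by (simp add: lagrangian_combine[OF m \<Lambda>(1) \<Lambda>(1)] d_def algebra_simps)
    then have "L m (combine_multipliers ?t \<Lambda> 0 \<Lambda>) = energy_of m + ?t * d" .
    also have "\<dots> = b" using \<Lambda>(2) by (simp add: d_def)
    finally show ?thesis
      using combine_multipliers_closed[OF \<Lambda>(1) \<Lambda>(1)] by (metis SUP_upper)
  qed
  then show ?thesis using False by (simp add: ereal_top)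
qed

lemma feasible_subset_N: "feasible \<subseteq> N"
  by (auto simp: feasible_measures_def)

lemma primal_value_eq:
  "primal_value X S n Y Z l f g h = (INF m\<in>N. SUP \<Lambda>\<in>M. ereal (L m \<Lambda>))"
proof -
  have "primal_value X S n Y Z l f g h = (INF m\<in>feasible. ereal (energy_of m))"
    unfolding primal_value_def by (intro INF_cong) auto
  also have "\<dots> = (INF m\<in>N. SUP \<Lambda>\<in>M. ereal (L m \<Lambda>))"
  proof (rule antisym)
    show "(INF m\<in>feasible. ereal (energy_of m)) \<le> (INF m\<in>N. SUP \<Lambda>\<in>M. ereal (L m \<Lambda>))"
      by (intro INF_greatest) (auto simp: SUP_lagrangian intro: INF_lower)
    show "(INF m\<in>N. SUP \<Lambda>\<in>M. ereal (L m \<Lambda>)) \<le> (INF m\<in>feasible. ereal (energy_of m))"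
    proof (rule INF_mono)
      fix m assume "m \<in> feasible"
      then show "\<exists>m'\<in>N. (SUP \<Lambda>\<in>M. ereal (L m' \<Lambda>)) \<le> ereal (energy_of m)"
        using feasible_subset_N by (intro bexI[of _ m]) (auto simp: SUP_lagrangian)
    qed
  qed
  finally show ?thesis .
qed

definition dual_functional :: "('n, 'm, 's) multiplier \<Rightarrow> ereal" where
  "dual_functional \<Lambda> =
     ereal (volume X) * (INF q\<in>\<Omega>. ereal (F \<Lambda> q)) +
     (\<Sum>i\<in>UNIV. ereal (area (S i)) * (INF p\<in>\<Gamma> i. ereal (G \<Lambda> i p)))"

lemma Omega_nonempty: "\<Omega> \<noteq> {}"
  using X YZ by (auto simp: Omega_def)

text \<open>An empty piece has area 0 because a cover by empty sets costs nothing, also for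
  \<open>d = 0\<close>, thanks to the separate weight of \<open>{}\<close> in
  \<open>hausdorff_pre\<close>.\<close>

lemma Gam_nonempty: "area (S i) = 0 \<or> \<Gamma> i \<noteq> {}"
proof (cases "S i = {}")
  case True
  have "hausdorff_pre d \<delta> ({} :: (real ^ 'n) set) = 0" if "0 < \<delta>" for d \<delta>
  proof -
    have "hausdorff_pre d \<delta> ({} :: (real ^ 'n) set) \<le>
        (\<Sum>k. if {} = ({} :: (real ^ 'n) set) then 0 else
          ennreal (unit_ball_vol (real d) * (diameter ({} :: (real ^ 'n) set) / 2) ^ d))"
      unfolding hausdorff_pre_def
      by (rule INF_lower2[of "\<lambda>k. {}"]) (use that in auto)
    then show ?thesis by simp
  qed
  then have "hausdorff d ({} :: (real ^ 'n) set) = 0" for d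
    unfolding hausdorff_def by (intro antisym SUP_least) auto
  then show ?thesis using True by (simp add: area_def surface_measure_def)
next
  case False
  then show ?thesis using YZ by (auto simp: Gam_def)
qed

lemma point_masses_in_N:
  assumes q: "q \<in> \<Omega>" and p: "\<And>i. area (S i) = 0 \<or> p i \<in> \<Gamma> i"
  obtains m where "m \<in> N"
    "\<And>\<Lambda>. \<Lambda> \<in> M \<Longrightarrow> L m \<Lambda> = volume X * F \<Lambda> q + (\<Sum>i\<in>UNIV. area (S i) * G \<Lambda> i (p i))"
proof -
  obtain \<mu> where \<mu>: "sets \<mu> = sets (restrict_space borel \<Omega>)" "emeasure \<mu> \<Omega> = ennreal (volume X)"
    "\<And>u :: _ \<Rightarrow> real. continuous_on \<Omega> u \<Longrightarrow> integrable \<mu> u \<and> (LINT x|\<mu>. u x) = volume X * u q"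
    using point_mass_exists[OF volume_nonneg, of q \<Omega>] q by blast
  have "\<exists>\<nu>. sets \<nu> = sets (restrict_space borel (\<Gamma> i)) \<and> emeasure \<nu> (\<Gamma> i) = ennreal (area (S i)) \<and>
    (\<forall>u :: _ \<Rightarrow> real. continuous_on (\<Gamma> i) u \<longrightarrow> integrable \<nu> u \<and> (LINT x|\<nu>. u x) = area (S i) * u (p i))" for i
    using point_mass_exists[OF area_nonneg p] by metis
  then obtain \<nu> where \<nu>: "\<And>i. sets (\<nu> i) = sets (restrict_space borel (\<Gamma> i))"
    "\<And>i. emeasure (\<nu> i) (\<Gamma> i) = ennreal (area (S i))"
    "\<And>i u :: _ \<Rightarrow> real. continuous_on (\<Gamma> i) u \<Longrightarrow>
       integrable (\<nu> i) u \<and> (LINT x|\<nu> i. u x) = area (S i) * u (p i)"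
    by metis
  have "(\<mu>, \<nu>) \<in> N"
    using \<mu> \<nu> by (intro N_intro) auto
  moreover have "L (\<mu>, \<nu>) \<Lambda> = volume X * F \<Lambda> q + (\<Sum>i\<in>UNIV. area (S i) * G \<Lambda> i (p i))"
    if "\<Lambda> \<in> M" for \<Lambda>
    using \<mu>(3)[OF continuous_F[OF that]] \<nu>(3)[OF continuous_G[OF that]] by (simp add: lagrangian_def)
  ultimately show ?thesis using that by blast
qed

text \<open>Integrals are bounded below by mass times infimum, and point masses at near-minimisers
  of \<open>F\<close> and of each \<open>G i\<close> come as close as desired, since the measures of
  a tuple are chosen independently.\<close>

lemma INF_lagrangian:
  assumes \<Lambda>: "\<Lambda> \<in> M"
  shows "(INF m\<in>N. ereal (L m \<Lambda>)) = dual_functional \<Lambda>"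
proof (rule antisym)
  show "dual_functional \<Lambda> \<le> (INF m\<in>N. ereal (L m \<Lambda>))"
  proof (rule INF_greatest)
    fix m assume "m \<in> N"
    then obtain \<mu> \<nu> where m: "m = (\<mu>, \<nu>)" and mN: "(\<mu>, \<nu>) \<in> N" by (cases m) auto
    have "dual_functional \<Lambda> \<le> ereal (LINT q|\<mu>. F \<Lambda> q) + (\<Sum>i\<in>UNIV. ereal (LINT p|\<nu> i. G \<Lambda> i p))"
      unfolding dual_functional_def
      by (intro add_mono sum_mono mass_INF_le_integral N_masses[OF mN] volume_nonneg area_nonneg
          N_integrable_FG[OF mN \<Lambda>])
    then show "dual_functional \<Lambda> \<le> ereal (L m \<Lambda>)"
      by (simp add: lagrangian_def m)
  qed
  show "(INF m\<in>N. ereal (L m \<Lambda>)) \<le> dual_functional \<Lambda>"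
  proof (rule ccontr)
    assume "\<not> ?thesis"
    then have "dual_functional \<Lambda> < (INF m\<in>N. ereal (L m \<Lambda>))" by simp
    then obtain b where b: "dual_functional \<Lambda> < ereal b" "ereal b < (INF m\<in>N. ereal (L m \<Lambda>))"
      using ereal_dense2 by blast
    \<comment> \<open>Indexing by \<open>option\<close> puts the interior term at
      \<open>None\<close> next to the boundary terms, so that one budget \<open>b\<close> is divided
      among all of them.\<close>
    define t where "t j = (case j of None \<Rightarrow> ereal (volume X) * (INF q\<in>\<Omega>. ereal (F \<Lambda> q))
      | Some i \<Rightarrow> ereal (area (S i)) * (INF p\<in>\<Gamma> i. ereal (G \<Lambda> i p)))" for j
    have "t j < \<infinity>" for j
      using mass_INF_less_top[OF volume_nonneg, of \<Omega>] mass_INF_less_top[OF area_nonneg Gam_nonempty] Omega_nonempty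
      by (auto simp: t_def split: option.split)
    moreover have "(\<Sum>j\<in>UNIV. t j) < ereal b"
      using b(1) by (simp add: sum_UNIV_option t_def dual_functional_def)
    ultimately obtain r where r: "\<And>j. t j < ereal (r j)" "(\<Sum>j\<in>UNIV. r j) \<le> b"
      using ereal_sum_less_obtain[of UNIV t b] by auto
    obtain q where q: "volume X = 0 \<or> q \<in> \<Omega>" "volume X * F \<Lambda> q \<le> r None"
      using INF_mass_less_obtain[of "volume X" "F \<Lambda>" \<Omega> "r None"] r(1)[of None] volume_nonneg Omega_nonempty
      by (auto simp: t_def)
    \<comment> \<open>If the volume is 0, then \<open>q\<close> may lie outside
      \<open>\<Omega>\<close>; any point of \<open>\<Omega>\<close> serves instead, as the product
      is 0.\<close>
    obtain q' where q': "q' \<in> \<Omega>" "volume X * F \<Lambda> q' \<le> r None"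
      using q Omega_nonempty by (cases "volume X = 0") auto
    have "\<exists>p. (area (S i) = 0 \<or> p \<in> \<Gamma> i) \<and> area (S i) * G \<Lambda> i p \<le> r (Some i)" for i
      using INF_mass_less_obtain[of "area (S i)" "G \<Lambda> i" "\<Gamma> i" "r (Some i)"] r(1)[of "Some i"]
        area_nonneg Gam_nonempty unfolding t_def option.case by metis
    then obtain p where p: "\<And>i. area (S i) = 0 \<or> p i \<in> \<Gamma> i"
      "\<And>i. area (S i) * G \<Lambda> i (p i) \<le> r (Some i)" by metis
    obtain m where m: "m \<in> N"
      "L m \<Lambda> = volume X * F \<Lambda> q' + (\<Sum>i\<in>UNIV. area (S i) * G \<Lambda> i (p i))"
      by (rule point_masses_in_N[OF q'(1) p(1)]) (use \<Lambda> in blast)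
    have "L m \<Lambda> \<le> r None + (\<Sum>i\<in>UNIV. r (Some i))"
      unfolding m(2) using q'(2) p(2) by (intro add_mono sum_mono) auto
    then have "L m \<Lambda> \<le> b"
      using r(2) by (simp add: sum_UNIV_option)
    moreover have "ereal b < ereal (L m \<Lambda>)"
      using b(2) INF_lower[OF m(1), of "\<lambda>m. ereal (L m \<Lambda>)"] by (rule less_le_trans)
    ultimately show False by simp
  qed
qed

lemma dual_value_eq:
  "dual_value X S n Y Z l f g h = (SUP \<Lambda>\<in>M. INF m\<in>N. ereal (L m \<Lambda>))"
  unfolding dual_value_def by (intro SUP_cong refl) (simp add: INF_lagrangian dual_functional_def)

lemma weak_duality: "dual_value X S n Y Z l f g h \<le> primal_value X S n Y Z l f g h"
  unfolding dual_value_eq primal_value_eq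
proof (rule SUP_least, rule INF_greatest)
  fix \<Lambda> m assume "\<Lambda> \<in> M" "m \<in> N"
  have "(INF m\<in>N. ereal (L m \<Lambda>)) \<le> ereal (L m \<Lambda>)"
    by (rule INF_lower[OF \<open>m \<in> N\<close>])
  also have "\<dots> \<le> (SUP \<Lambda>\<in>M. ereal (L m \<Lambda>))"
    by (rule SUP_upper[OF \<open>\<Lambda> \<in> M\<close>])
  finally show "(INF m\<in>N. ereal (L m \<Lambda>)) \<le> (SUP \<Lambda>\<in>M. ereal (L m \<Lambda>))"
    .
qed

lemma strong_duality:
  assumes "bounded Y" "bounded Z"
  shows "primal_value X S n Y Z l f g h = dual_value X S n Y Z l f g h"
proof (rule antisym[OF _ weak_duality], rule ccontr)
  assume "\<not> primal_value X S n Y Z l f g h \<le> dual_value X S n Y Z l f g h"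
  then have "dual_value X S n Y Z l f g h < primal_value X S n Y Z l f g h" by (simp only: not_le)
  from ereal_dense2[OF this] obtain b
    where b: "dual_value X S n Y Z l f g h < ereal b" "ereal b < primal_value X S n Y Z l f g h"
    by metis
  \<comment> \<open>Boundedness of \<open>Y\<close> and \<open>Z\<close> enters through the
    compactness of these sets.\<close>
  have \<Omega>_compact: "compact \<Omega>"
    using X assms by (auto simp: Omega_def intro!: compact_Times)
  have \<Gamma>_compact: "compact (\<Gamma> i)" for i
    using S assms by (auto simp: Gam_def intro!: compact_Times)
  define A where "A = pos_functionals \<Omega> (volume X) \<times> PiE UNIV (\<lambda>i. pos_functionals (\<Gamma> i) (area (S i)))"
  \<comment> \<open>The Lagrangian carried over to functionals: it agrees with \<open>L\<close> when
    \<open>P\<close> consists of the integrals against a tuple in \<open>N\<close>.\<close>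
  define v where "v \<Lambda> P = fst P (F \<Lambda>) + (\<Sum>i\<in>UNIV. snd P i (G \<Lambda> i))"
    for \<Lambda> and P :: "((('n, 'm) jet \<Rightarrow> real) \<Rightarrow> real) \<times> ('s \<Rightarrow> (('n, 'm) pt \<Rightarrow> real) \<Rightarrow> real)"
  have A_D: "fst P \<in> pos_functionals \<Omega> (volume X)" "snd P i \<in> pos_functionals (\<Gamma> i) (area (S i))"
    if "P \<in> A" for P i
    using that by (auto simp: A_def PiE_def Pi_def)
  have "\<exists>P\<in>A. \<forall>w\<in>v ` M. w P \<le> b"
  proof (rule compact_minimax)
    show "compact A"
      unfolding A_def
      by (intro compact_Times compact_PiE_UNIV compact_pos_functionals \<Omega>_compact \<Gamma>_compact)
    show "v ` M \<noteq> {}" using zero_M by blast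
  next
    fix w assume "w \<in> v ` M"
    then obtain \<Lambda> where w: "w = v \<Lambda>" "\<Lambda> \<in> M" by blast
    show "continuous_on UNIV w"
      unfolding w v_def
      by (intro continuous_on_add continuous_on_sum continuous_on_fst_apply continuous_on_snd_apply)
    have "(INF m\<in>N. ereal (L m \<Lambda>)) \<le> dual_value X S n Y Z l f g h"
      unfolding dual_value_eq by (rule SUP_upper[OF w(2), of "\<lambda>\<Lambda>. INF m\<in>N. ereal (L m \<Lambda>)"])
    then have "(INF m\<in>N. ereal (L m \<Lambda>)) < ereal b"
      using b(1) by (rule order_le_less_trans)
    then obtain m where m: "m \<in> N" "ereal (L m \<Lambda>) < ereal b"
      unfolding INF_less_iff by (elim bexE)
    obtain \<mu> \<nu> where "m = (\<mu>, \<nu>)" by (cases m)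
    with m have mN: "(\<mu>, \<nu>) \<in> N" and less: "L (\<mu>, \<nu>) \<Lambda> < b" by simp_all
    define P where "P = (\<lambda>u :: _ \<Rightarrow> real. if continuous_on \<Omega> u then LINT x|\<mu>. u x else 0,
      \<lambda>i (u :: _ \<Rightarrow> real). if continuous_on (\<Gamma> i) u then LINT x|\<nu> i. u x else 0)"
    have "P \<in> A"
      unfolding A_def P_def
      by (auto intro!: integral_pos_functional N_masses[OF mN] \<Omega>_compact \<Gamma>_compact volume_nonneg area_nonneg)
    moreover have "w P = L (\<mu>, \<nu>) \<Lambda>"
      by (simp add: w v_def P_def continuous_F continuous_G lagrangian_def)
    ultimately show "\<exists>P\<in>A. w P < b" using less by metis
  next
    fix P Q and t :: real assume PQ: "P \<in> A" "Q \<in> A" and t: "0 \<le> t" "t \<le> 1"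
    define R where "R = (\<lambda>u. (1 - t) * fst P u + t * fst Q u, \<lambda>i u. (1 - t) * snd P i u + t * snd Q i u)"
    have "R \<in> A"
      unfolding R_def A_def using A_D[OF PQ(1)] A_D[OF PQ(2)] t by (auto intro!: pos_functionals_convex)
    moreover have "v \<Lambda> R = (1 - t) * v \<Lambda> P + t * v \<Lambda> Q" for \<Lambda>
      by (simp add: v_def R_def sum.distrib sum_distrib_left distrib_left)
    ultimately show "\<exists>R\<in>A. \<forall>w\<in>v ` M. w R = (1 - t) * w P + t * w Q" by blast
  next
    fix p q and t :: real assume "p \<in> v ` M" "q \<in> v ` M"
    then obtain \<Lambda> \<Lambda>' where p: "p = v \<Lambda>" "\<Lambda> \<in> M" and q: "q = v \<Lambda>'" "\<Lambda>' \<in> M" by blast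
    define \<Xi> where "\<Xi> = combine_multipliers (1 - t) \<Lambda> t \<Lambda>'"
    \<comment> \<open>The weights add up to 1, so the extra multiple of \<open>l\<close> in
      \<open>F_fun_combine\<close> drops out.\<close>
    have F_eq: "F \<Xi> = (\<lambda>x. (1 - t) * F \<Lambda> x + t * F \<Lambda>' x)"
      and G_eq: "G \<Xi> i = (\<lambda>x. (1 - t) * G \<Lambda> i x + t * G \<Lambda>' i x)" for i
      unfolding \<Xi>_def using F_fun_combine[OF p(2) q(2), of l f g "1 - t" t] G_fun_combine[of n h "1 - t" \<Lambda> t \<Lambda>' i]
      by (simp_all add: fun_eq_iff del: combine_multipliers.simps)
    have "v \<Xi> P = (1 - t) * p P + t * q P" if P: "P \<in> A" for P
    proof -
      have "fst P (F \<Xi>) = (1 - t) * fst P (F \<Lambda>) + t * fst P (F \<Lambda>')"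
        unfolding F_eq using p q
        by (simp add: pos_functional_add[OF A_D(1)[OF P]] pos_functional_cmult[OF A_D(1)[OF P]]
            continuous_F continuous_on_mult_left)
      moreover have "snd P i (G \<Xi> i) = (1 - t) * snd P i (G \<Lambda> i) + t * snd P i (G \<Lambda>' i)" for i
        unfolding G_eq using p q
        by (simp add: pos_functional_add[OF A_D(2)[OF P]] pos_functional_cmult[OF A_D(2)[OF P]]
            continuous_G continuous_on_mult_left)
      ultimately show ?thesis
        by (simp add: p(1) q(1) v_def sum.distrib sum_distrib_left distrib_left)
    qed
    then show "\<exists>r\<in>v ` M. \<forall>P\<in>A. r P = (1 - t) * p P + t * q P"
      using combine_multipliers_closed[OF p(2) q(2)] unfolding \<Xi>_def by blast
  qed
  then obtain P where P: "P \<in> A" "\<And>\<Lambda>. \<Lambda> \<in> M \<Longrightarrow> v \<Lambda> P \<le> b" by blast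
  obtain \<mu> where \<mu>: "sets \<mu> = sets (restrict_space borel \<Omega>)" "emeasure \<mu> \<Omega> = ennreal (volume X)"
    "\<And>u. continuous_on \<Omega> u \<Longrightarrow> integrable \<mu> u \<and> (LINT x|\<mu>. u x) = fst P u"
    using riesz_representation_compact[OF \<Omega>_compact A_D(1)[OF P(1)]] by metis
  have "\<exists>\<nu>. sets \<nu> = sets (restrict_space borel (\<Gamma> i)) \<and> emeasure \<nu> (\<Gamma> i) = ennreal (area (S i)) \<and>
    (\<forall>u. continuous_on (\<Gamma> i) u \<longrightarrow> integrable \<nu> u \<and> (LINT x|\<nu>. u x) = snd P i u)" for i
    using riesz_representation_compact[OF \<Gamma>_compact A_D(2)[OF P(1)]] by metis
  then obtain \<nu> where \<nu>: "\<And>i. sets (\<nu> i) = sets (restrict_space borel (\<Gamma> i))"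
    "\<And>i. emeasure (\<nu> i) (\<Gamma> i) = ennreal (area (S i))"
    "\<And>i u. continuous_on (\<Gamma> i) u \<Longrightarrow> integrable (\<nu> i) u \<and> (LINT x|\<nu> i. u x) = snd P i u"
    by metis
  have mN: "(\<mu>, \<nu>) \<in> N"
    using \<mu> \<nu> by (intro N_intro) auto
  have "L (\<mu>, \<nu>) \<Lambda> \<le> b" if "\<Lambda> \<in> M" for \<Lambda>
    using P(2)[OF that] \<mu>(3)[OF continuous_F[OF that]] \<nu>(3)[OF continuous_G[OF that]]
    by (simp add: lagrangian_def v_def)
  then have "(SUP \<Lambda>\<in>M. ereal (L (\<mu>, \<nu>) \<Lambda>)) \<le> ereal b"
    by (intro SUP_least) simp
  then have "primal_value X S n Y Z l f g h \<le> ereal b"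
    unfolding primal_value_eq by (rule INF_lower2[OF mN])
  then show False using b(2) by simp
qed

end

text \<open>A nonempty open set is not negligible, so a property that holds almost everywhere on it
  holds somewhere.\<close>

lemma AE_nonempty_open:
  fixes X :: "'a::euclidean_space set"
  assumes "open X" "X \<noteq> {}" "AE x in lebesgue_on X. P x"
  shows "\<exists>x. P x"
proof (rule ccontr)
  assume "\<not> ?thesis"
  then have "AE x in lebesgue_on X. False" using assms(3) by simp
  moreover have X: "X \<in> sets lebesgue"
    using assms(1) by (intro sets_completionI_sets) simp
  ultimately have "AE x in lebesgue. x \<notin> X"
    by (simp add: AE_restrict_space_iff)
  then have "negligible X"
    using X by (simp add: negligible_iff_null_sets AE_iff_null_sets)
  then show False using assms(1,2) open_not_negligible by blast
qed

theorem theorem1: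
  fixes X :: "(real ^ 'n) set"
    and S :: "'s::finite \<Rightarrow> (real ^ 'n) set"
    and n :: "'s \<Rightarrow> real ^ 'n \<Rightarrow> real ^ 'n"
    and Y :: "(real ^ 'm) set"
    and Z :: "(real ^ 'n ^ 'm) set"
    and l f g :: "('n, 'm) jet \<Rightarrow> real"
    and h :: "'s \<Rightarrow> ('n, 'm) pt \<Rightarrow> real"
  assumes "variational_domain X S n"
    and "continuous_on (closure X \<times> UNIV) l"
    and "continuous_on (closure X \<times> UNIV) f"
    and "continuous_on (closure X \<times> UNIV) g"
    and "\<And>i. continuous_on (S i \<times> UNIV) (h i)"
    and "admissible X S Y Z f g h \<noteq> {}"
    and "bdd_below (energy X l ` admissible X S Y Z f g h)"
  shows
    "primal_value X S n Y Z l f g h =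
       (INF m \<in> measures_N X S n Y Z l f g h. SUP \<Lambda> \<in> multipliers X S Y Z.
          ereal (lagrangian n l f g h m \<Lambda>)) \<and>
     dual_value X S n Y Z l f g h =
       (SUP \<Lambda> \<in> multipliers X S Y Z. INF m \<in> measures_N X S n Y Z l f g h.
          ereal (lagrangian n l f g h m \<Lambda>)) \<and>
     dual_value X S n Y Z l f g h \<le> primal_value X S n Y Z l f g h \<and>
     (bounded Y \<longrightarrow> bounded Z \<longrightarrow>
        primal_value X S n Y Z l f g h = dual_value X S n Y Z l f g h)"
proof -
  have domain: "X \<noteq> {}" "open X" "bounded X" "frontier X = (\<Union>i. S i)"
    "\<And>i. smooth_piece X (S i)" "\<And>i. outward_unit_normal X (S i) (n i)"
    using assms(1) by (simp_all add: variational_domain_def)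
  \<comment> \<open>The values of an admissible \<open>u\<close> and of its weak Jacobian provide
    points of \<open>Y\<close> and \<open>Z\<close>, hence of \<open>\<Omega>\<close>.\<close>
  obtain u where u: "AE x in lebesgue_on X. u x \<in> Y" "AE x in lebesgue_on X. Dw X u x \<in> Z"
    using assms(6) by (auto simp: admissible_def)
  have S_closure: "S i \<subseteq> closure X" for i
    using domain(4) by (auto simp: frontier_def)
  interpret relaxed_program X S n Y Z l f g h
  proof
    show "bounded X" "X \<noteq> {}" using domain by auto
    show "compact (S i)" for i
      unfolding compact_eq_bounded_closed
      using domain(5)[of i] bounded_subset[OF bounded_closure[OF domain(3)] S_closure]
      by (simp add: smooth_piece_def)
    show "continuous_on (S i) (n i)" for i
      using domain(6)[of i] by (simp add: outward_unit_normal_def)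
    show "Y \<noteq> {}" "Z \<noteq> {}"
      using AE_nonempty_open[OF domain(2,1) u(1)] AE_nonempty_open[OF domain(2,1) u(2)] by auto
    have "Omega X Y Z \<subseteq> closure X \<times> UNIV" by (auto simp: Omega_def)
    then show "continuous_on (Omega X Y Z) l" "continuous_on (Omega X Y Z) f" "continuous_on (Omega X Y Z) g"
      using assms(2-4) by (auto intro: continuous_on_subset)
    show "continuous_on (Gam S Y i) (h i)" for i
      using assms(5)[of i] by (rule continuous_on_subset) (auto simp: Gam_def)
  qed
  show ?thesis
    using primal_value_eq dual_value_eq weak_duality strong_duality by blast
qed

end
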